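(* Let $K$ be an arbitrary field, let $n,m\geq 1$ be integers, and let $\mathcal H=\mathrm{Mat}(n)\oplus\cdots\oplus\mathrm{Mat}(n)$ be the direct sum of $m$ copies of the space of $n\times n$ matrices with entries in $K$. Let $X_1,\dots,X_m$ be the matrices of standard coordinate functions on the $m$ components of $\mathcal H$, and let the group $U=\mathrm{UT}(n)$ of upper unitriangular matrices act on $\mathcal H$ by simultaneous conjugation. Consider the following systems of polynomials: $$\mathbb P_{1,\ell}=\{P_{ik}(X_1,X_\ell):\ 1\leq i'<k\leq n\}\quad\text{for each } 2\leq \ell\leq m,$$ $$\mathbb P_\ell=\{P_{ik}(X_\ell):\ 1\leq i'<k\leq n\}\quad\text{for each } 1\leq \ell\leq m,$$ $$\mathbb D_\ell=\{D_k(X_\ell):\ 1\leq k\leq n\}\quad\text{for each } 1\leq \ell\leq m.$$ Then the field of invariants $K(\mathcal H)^U$ is freely generated over $K$ by the system of polynomials $$\mathbb B=\left(\bigcup_{\ell=2}^m \mathbb P_{1,\ell}\right)\cup\left(\bigcup_{\ell=1}^m\mathbb P_\ell\right)\cup\left(\bigcup_{\ell=1}^m\mathbb D_\ell\right).$$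
   Context: For $1\leq i\leq n$ put $i'=n-i+1$. For integers $a,b$, $[a,b]$ denotes the set of integers $i$ with $a\leq i\leq b$ (empty if $a>b$). All minors are taken with rows and columns in increasing order. For an $n\times n$ matrix $X=(x_{ij})$ and a pair $(i,j)$ with $i'\leq j$, $M_{ij}(X)$ is the minor of $X$ of order $i'$ with rows $[i,n]$ and columns $[1,i'-1]\sqcup\{j\}$. For an $n\times n$ matrix $Y=(y_{ij})$ and a pair $(j,k)$ with $j\leq k$, $N_{jk}(Y)$ is the minor of $Y$ of order $k'$ with rows $\{j\}\sqcup[k+1,n]$ and columns $[1,k']$. For $i'<k$ define $$P_{ik}(X,Y)=\sum_{i'\leq j\leq k}M_{ij}(X)N_{jk}(Y),\qquad P_{ik}(X)=P_{ik}(X,X).$$ For $1\leq k\leq n$, $D_k(X)$ is the lower left corner minor of order $k'$ of $X$ (rows $[k,n]$, columns $[1,k']$). $K[\mathcal H]$ is the algebra of regular functions on $\mathcal H$, i.e. the polynomial ring over $K$ in the $mn^2$ entries of $X_1,\dots,X_m$, and $K(\mathcal H)$ is the field of rational functions on $\mathcal H$, its field of fractions. $\mathrm{GL}(n)$ is the general linear group of order $n$ over $K$, and $U=\mathrm{UT}(n)\subset\mathrm{GL}(n)$ is the subgroup of upper triangular matrices with ones on the diagonal. The group $\mathrm{GL}(n)$, hence $U$, acts on $\mathcal H$ by $\mathrm{Ad}_g(X_1,\dots,X_m)=(gX_1g^{-1},\dots,gX_mg^{-1})$ and on $K[\mathcal H]$ by $(\rho(g)f)(X_1,\dots,X_m)=f(g^{-1}X_1g,\dots,g^{-1}X_mg)$;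 the latter action extends to $K(\mathcal H)$. $K(\mathcal H)^U$ is the subfield of $U$-invariants, i.e. of those $f\in K(\mathcal H)$ with $\rho(g)f=f$ for all $g\in U$. A field $F\supseteq K$ is freely generated over $K$ by a system of elements if these elements are algebraically independent over $K$ and generate $F$ as a field over $K$.
   Formalization: For finite K and n≥2 the claim fails (U is finite, so K(H)^U has transcendence degree mn² > |B|); it is proved literally for infinite K, and for every field K with K(H)^U taken as the f in K(H) fixed by all unitriangular matrices over the algebraic closure of K. *)

theory Defs
  imports
    "HOL-Library.Poly_Mapping"
    "HOL-Library.Countable"
    "HOL-Computational_Algebra.Fraction_Field"
    "HOL-Algebra.Algebraic_Closure_Type"
    "Jordan_Normal_Form.Determinant"
    "Jordan_Normal_Form.DL_Submatrix"
begin

section \<open>Multivariate polynomials\<close>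

text \<open>A polynomial with coefficients in \<open>'k\<close> and variables in \<open>'v\<close> is a finitely supported map
  from monomials \<open>'v \<Rightarrow>\<^sub>0 nat\<close> to coefficients; the ring structure is the convolution product of
  \<^theory>\<open>HOL-Library.Poly_Mapping\<close>.\<close>

definition Const :: "'k \<Rightarrow> ('v \<Rightarrow>\<^sub>0 nat) \<Rightarrow>\<^sub>0 'k::zero"
  where "Const c = Poly_Mapping.single 0 c"

definition Var :: "'v \<Rightarrow> ('v \<Rightarrow>\<^sub>0 nat) \<Rightarrow>\<^sub>0 'k::zero_neq_one"
  where "Var v = Poly_Mapping.single (Poly_Mapping.single v 1) 1"

definition vars :: "(('v \<Rightarrow>\<^sub>0 nat) \<Rightarrow>\<^sub>0 'k::zero) \<Rightarrow> 'v set"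
  where "vars p = (\<Union>u\<in>Poly_Mapping.keys p. Poly_Mapping.keys u)"

text \<open>Evaluation at the point \<open>s\<close>, the coefficients being transported by \<open>\<phi>\<close>.\<close>

definition poly_eval :: "('k::zero \<Rightarrow> 'r) \<Rightarrow> ('v \<Rightarrow> 'r) \<Rightarrow> (('v \<Rightarrow>\<^sub>0 nat) \<Rightarrow>\<^sub>0 'k) \<Rightarrow> 'r::comm_ring_1"
  where "poly_eval \<phi> s p =
    (\<Sum>u\<in>Poly_Mapping.keys p. \<phi> (Poly_Mapping.lookup p u) *
       (\<Prod>v\<in>Poly_Mapping.keys u. s v ^ Poly_Mapping.lookup u v))"


section \<open>Freely generated field extensions\<close>

definition is_subfield :: "'f::field set \<Rightarrow> bool"
  where "is_subfield F \<longleftrightarrow> 0 \<in> F \<and> 1 \<in> F \<and>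
    (\<forall>x\<in>F. \<forall>y\<in>F. x + y \<in> F \<and> x * y \<in> F) \<and> (\<forall>x\<in>F. - x \<in> F \<and> inverse x \<in> F)"

definition field_generated :: "'f::field set \<Rightarrow> 'f set"
  where "field_generated S = \<Inter>{F. is_subfield F \<and> S \<subseteq> F}"

text \<open>Here \<open>\<phi>\<close> is the embedding of the base field. Independence is that of a family, so it
  includes that members with different indices are different.\<close>

definition algebraically_independent :: "('k::field \<Rightarrow> 'f::field) \<Rightarrow> 'i set \<Rightarrow> ('i \<Rightarrow> 'f) \<Rightarrow> bool"
  where "algebraically_independent \<phi> I b \<longleftrightarrow>
    (\<forall>p :: ('i \<Rightarrow>\<^sub>0 nat) \<Rightarrow>\<^sub>0 'k. vars p \<subseteq> I \<and> poly_eval \<phi> b p = 0 \<longrightarrow> p = 0)"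

definition freely_generated :: "('k::field \<Rightarrow> 'f::field) \<Rightarrow> 'f set \<Rightarrow> 'i set \<Rightarrow> ('i \<Rightarrow> 'f) \<Rightarrow> bool"
  where "freely_generated \<phi> F I b \<longleftrightarrow>
    algebraically_independent \<phi> I b \<and> F = field_generated (range \<phi> \<union> b ` I)"


section \<open>The rings \<open>K[\<H>]\<close> and \<open>K(\<H>)\<close>\<close>

text \<open>\<open>Coord l i j\<close> is the entry \<open>(i, j)\<close> of the \<open>l\<close>-th matrix; all three indices start at 1.\<close>

datatype coord = Coord nat nat nat

instance coord :: countable
  by countable_datatype

text \<open>The order carries no meaning: \<^theory>\<open>HOL-Library.Poly_Mapping\<close> asks for some linear order on
  the variables to make the polynomials an integral domain.\<close>

instantiation coord :: linorder
begin

definition less_eq_coord :: "coord \<Rightarrow> coord \<Rightarrow> bool"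
  where "(x::coord) \<le> y \<longleftrightarrow> to_nat x \<le> to_nat y"

definition less_coord :: "coord \<Rightarrow> coord \<Rightarrow> bool"
  where "(x::coord) < y \<longleftrightarrow> to_nat x < to_nat y"

instance
  by standard (auto simp: less_eq_coord_def less_coord_def)

end

type_synonym 'k pol = "(coord \<Rightarrow>\<^sub>0 nat) \<Rightarrow>\<^sub>0 'k"

definition polyH :: "nat \<Rightarrow> nat \<Rightarrow> 'k::field pol set"
  where "polyH n m = {p. vars p \<subseteq> {Coord l i j | l i j. l \<in> {1..m} \<and> i \<in> {1..n} \<and> j \<in> {1..n}}}"

definition ratH :: "nat \<Rightarrow> nat \<Rightarrow> 'k::field pol fract set"
  where "ratH n m = {Fract p q | p q. p \<in> polyH n m \<and> q \<in> polyH n m \<and> q \<noteq> 0}"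

definition scalar :: "'k::field \<Rightarrow> 'k pol fract"
  where "scalar c = Fract (Const c) 1"

text \<open>Matrices of \<^theory>\<open>Jordan_Normal_Form.Matrix\<close> are indexed from 0, hence the shifts
  here and in \<open>minor\<close> below.\<close>

definition coord_mat :: "nat \<Rightarrow> nat \<Rightarrow> 'k::field pol mat"
  where "coord_mat n l = mat n n (\<lambda>(a, b). Var (Coord l (Suc a) (Suc b)))"


section \<open>The action of \<open>UT(n)\<close> and its invariants\<close>

text \<open>The extension to fractions of a map \<open>h\<close> defined on a subring \<open>A\<close>. The result does not depend
  on the chosen fraction if \<open>h\<close> is an injective homomorphism on \<open>A\<close>.\<close>

definition frac_lift :: "'a set \<Rightarrow> ('a::idom \<Rightarrow> 'b::idom) \<Rightarrow> 'a fract \<Rightarrow> 'b fract"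
  where "frac_lift A h f =
    (SOME f'. \<exists>p\<in>A. \<exists>q\<in>A. q \<noteq> 0 \<and> f = Fract p q \<and> f' = Fract (h p) (h q))"

lemma frac_lift_Fract:
  assumes mult: "\<And>x y. x \<in> A \<Longrightarrow> y \<in> A \<Longrightarrow> h (x * y) = h x * h y"
    and nz: "\<And>x. x \<in> A \<Longrightarrow> x \<noteq> 0 \<Longrightarrow> h x \<noteq> 0"
    and pq: "p \<in> A" "q \<in> A" "q \<noteq> 0"
  shows "frac_lift A h (Fract p q) = Fract (h p) (h q)"
  unfolding frac_lift_def
proof (rule some_equality)
  show "\<exists>p'\<in>A. \<exists>q'\<in>A. q' \<noteq> 0 \<and> Fract p q = Fract p' q' \<and> Fract (h p) (h q) = Fract (h p') (h q')"
    using pq by blast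
next
  fix f' assume "\<exists>p'\<in>A. \<exists>q'\<in>A. q' \<noteq> 0 \<and> Fract p q = Fract p' q' \<and> f' = Fract (h p') (h q')"
  then obtain p' q' where *: "p' \<in> A" "q' \<in> A" "q' \<noteq> 0" "Fract p q = Fract p' q'"
    "f' = Fract (h p') (h q')" by blast
  then have "p * q' = p' * q" using pq by (simp add: eq_fract)
  then have "h p * h q' = h p' * h q" using mult pq * by metis
  then show "f' = Fract (h p) (h q)" using * pq nz by (simp add: eq_fract)
qed

definition UT :: "nat \<Rightarrow> 'k::field mat set"
  where "UT n = {g \<in> carrier_mat n n. upper_triangular g \<and> (\<forall>i<n. g $$ (i, i) = 1)}"

text \<open>\<open>(\<rho>(g) f)(X\<^sub>1, \<dots>, X\<^sub>m) = f(g\<inverse> X\<^sub>1 g, \<dots>, g\<inverse> X\<^sub>m g)\<close>\<close>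

definition rho :: "nat \<Rightarrow> 'k::field mat \<Rightarrow> 'k pol \<Rightarrow> 'k pol"
  where "rho n g = poly_eval Const (\<lambda>v. case v of Coord l i j \<Rightarrow>
    (map_mat Const (m_inv (ring_mat TYPE('k) n ()) g) * coord_mat n l * map_mat Const g) $$ (i - 1, j - 1))"

text \<open>Invariants of the abstract group \<open>UT(n)\<close> of matrices with entries in the base field.\<close>

definition invariants :: "nat \<Rightarrow> nat \<Rightarrow> 'k::field pol fract set"
  where "invariants n m = {f \<in> ratH n m. \<forall>g\<in>UT n. frac_lift (polyH n m) (rho n g) f = f}"

text \<open>Invariants of the algebraic group \<open>UT(n)\<close> over \<open>'k\<close>: the rational functions over \<open>'k\<close> that are
  fixed by all unitriangular matrices with entries in the algebraic closure of \<open>'k\<close>. Over an infinite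
  field these are the same rational functions as in \<open>invariants\<close>. Over a finite field the group of
  rational points is finite, so its invariants always have transcendence degree \<open>m * n\<^sup>2\<close>, and the
  algebraic group is the one to consider.\<close>

definition alg_invariants :: "nat \<Rightarrow> nat \<Rightarrow> 'k::field pol fract set"
  where "alg_invariants n m =
    {f \<in> ratH n m. frac_lift (polyH n m) (Poly_Mapping.map to_ac) f \<in> invariants n m}"


section \<open>The generators\<close>

definition minor :: "'r::comm_ring_1 mat \<Rightarrow> nat set \<Rightarrow> nat set \<Rightarrow> 'r"
  where "minor A R C = det (submatrix A {a. Suc a \<in> R} {b. Suc b \<in> C})"

text \<open>\<open>i' = n - i + 1\<close>, used for \<open>1 \<le> i \<le> n\<close> only.\<close>

definition opp :: "nat \<Rightarrow> nat \<Rightarrow> nat"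
  where "opp n i = n - i + 1"

definition minorM :: "nat \<Rightarrow> nat \<Rightarrow> nat \<Rightarrow> 'r::comm_ring_1 mat \<Rightarrow> 'r"
  where "minorM n i j A = minor A {i..n} ({1..opp n i - 1} \<union> {j})"

definition minorN :: "nat \<Rightarrow> nat \<Rightarrow> nat \<Rightarrow> 'r::comm_ring_1 mat \<Rightarrow> 'r"
  where "minorN n j k B = minor B ({j} \<union> {k + 1..n}) {1..opp n k}"

definition polyP :: "nat \<Rightarrow> nat \<Rightarrow> nat \<Rightarrow> 'r::comm_ring_1 mat \<Rightarrow> 'r mat \<Rightarrow> 'r"
  where "polyP n i k A B = (\<Sum>j\<in>{opp n i..k}. minorM n i j A * minorN n j k B)"

definition polyD :: "nat \<Rightarrow> nat \<Rightarrow> 'r::comm_ring_1 mat \<Rightarrow> 'r"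
  where "polyD n k A = minor A {k..n} {1..opp n k}"

text \<open>\<open>GenP1 l i k\<close>, \<open>GenP l i k\<close> and \<open>GenD l k\<close> index \<open>P\<^sub>i\<^sub>k(X\<^sub>1, X\<^sub>l)\<close>, \<open>P\<^sub>i\<^sub>k(X\<^sub>l)\<close> and \<open>D\<^sub>k(X\<^sub>l)\<close>.\<close>

datatype gen_index = GenP1 nat nat nat | GenP nat nat nat | GenD nat nat

definition B_index :: "nat \<Rightarrow> nat \<Rightarrow> gen_index set"
  where "B_index n m =
    (\<Union>l\<in>{2..m}. {GenP1 l i k | i k. i \<in> {1..n} \<and> k \<in> {1..n} \<and> opp n i < k}) \<union>
    (\<Union>l\<in>{1..m}. {GenP l i k | i k. i \<in> {1..n} \<and> k \<in> {1..n} \<and> opp n i < k}) \<union>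
    (\<Union>l\<in>{1..m}. {GenD l k | k. k \<in> {1..n}})"

fun B_elem :: "nat \<Rightarrow> gen_index \<Rightarrow> 'k::field pol"
  where
    "B_elem n (GenP1 l i k) = polyP n i k (coord_mat n 1) (coord_mat n l)"
  | "B_elem n (GenP l i k) = polyP n i k (coord_mat n l) (coord_mat n l)"
  | "B_elem n (GenD l k) = polyD n k (coord_mat n l)"

end

theory Submission
  imports Defs
begin

text \<open>Let \<open>L(X)\<close> and \<open>N(X)\<close> be the matrices of the minors \<open>M\<^sub>i\<^sub>j(X)\<close> (rows reversed) and \<open>N\<^sub>j\<^sub>k(X)\<close>. Both are
  upper triangular with corner minors on the diagonal, \<open>L(g X g\<inverse>) = L(X) g\<inverse>\<close> and \<open>N(g X g\<inverse>) = g N(X)\<close>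
  for unitriangular \<open>g\<close>, and \<open>P\<^sub>i\<^sub>k(X, Y)\<close> are the entries of \<open>L(X) N(Y)\<close>; so these are invariant.
  Over a field, \<open>L(X)\<close> and \<open>N(X)\<close> with nonzero diagonals determine \<open>X\<close> rationally and may be prescribed
  arbitrarily, up to the compatibility of the diagonals.

  Independence: every choice of values of the generators, the \<open>D\<^sub>k\<close> being nonzero, is attained at some
  point of the slice where \<open>L(X\<^sub>1)\<close> is diagonal; take independent variables as values.

  Generation: let \<open>g = D\<inverse> L(X\<^sub>1)\<close> with \<open>D\<close> the diagonal of \<open>L(X\<^sub>1)\<close>, and \<open>Z\<^sub>l = g X\<^sub>l g\<inverse>\<close>. Then
  \<open>N(Z\<^sub>l) = D\<inverse> L(X\<^sub>1) N(X\<^sub>l)\<close> and \<open>L(Z\<^sub>l) N(Z\<^sub>l) = L(X\<^sub>l) N(X\<^sub>l)\<close> have entries in the field \<open>K\<close> generated by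
  the system, hence so has \<open>Z\<^sub>l\<close>. An invariant rational function is not changed by the substitution of
  \<open>Z\<close>, or of \<open>w Z w\<inverse>\<close> with \<open>w\<close> unitriangular over \<open>K\<close>, for \<open>X\<close>, so it lies in \<open>K\<close>.\<close>

section \<open>Evaluation of multivariate polynomials\<close>

definition mono_eval :: "('v \<Rightarrow> 'r) \<Rightarrow> ('v \<Rightarrow>\<^sub>0 nat) \<Rightarrow> 'r::comm_ring_1"
  where "mono_eval s u = (\<Prod>v\<in>Poly_Mapping.keys u. s v ^ Poly_Mapping.lookup u v)"

lemma mono_eval_superset:
  assumes "finite S" "Poly_Mapping.keys u \<subseteq> S"
  shows "mono_eval s u = (\<Prod>v\<in>S. s v ^ Poly_Mapping.lookup u v)"
  unfolding mono_eval_def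
  by (rule prod.mono_neutral_left) (use assms in \<open>auto simp: in_keys_iff\<close>)

lemma mono_eval_zero [simp]: "mono_eval s 0 = 1"
  by (simp add: mono_eval_def)

lemma mono_eval_add: "mono_eval s (u + w) = mono_eval s u * mono_eval s w"
proof -
  let ?S = "Poly_Mapping.keys u \<union> Poly_Mapping.keys w"
  have "mono_eval s (u + w) = (\<Prod>v\<in>?S. s v ^ Poly_Mapping.lookup (u + w) v)"
    by (rule mono_eval_superset) (simp_all add: keys_add)
  also have "\<dots> = (\<Prod>v\<in>?S. s v ^ Poly_Mapping.lookup u v) * (\<Prod>v\<in>?S. s v ^ Poly_Mapping.lookup w v)"
    by (simp add: lookup_add power_add prod.distrib)
  also have "\<dots> = mono_eval s u * mono_eval s w"
    by (simp add: mono_eval_superset[of ?S])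
  finally show ?thesis .
qed

lemma mono_eval_single [simp]: "mono_eval s (Poly_Mapping.single v k) = s v ^ k"
  by (cases "k = 0") (simp_all add: mono_eval_def)

lemma poly_eval_mono_eval:
  "poly_eval \<phi> s p = (\<Sum>u\<in>Poly_Mapping.keys p. \<phi> (Poly_Mapping.lookup p u) * mono_eval s u)"
  by (simp add: poly_eval_def mono_eval_def)

lemma poly_mapping_sum_single:
  "p = (\<Sum>u\<in>Poly_Mapping.keys p. Poly_Mapping.single u (Poly_Mapping.lookup p u))"
  by (rule poly_mapping_eqI) (auto simp: lookup_sum lookup_single when_def in_keys_iff)

lemma poly_eval_superset:
  assumes "\<phi> 0 = 0" "finite S" "Poly_Mapping.keys p \<subseteq> S"
  shows "poly_eval \<phi> s p = (\<Sum>u\<in>S. \<phi> (Poly_Mapping.lookup p u) * mono_eval s u)"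
  unfolding poly_eval_mono_eval
  by (rule sum.mono_neutral_left) (use assms in \<open>auto simp: in_keys_iff\<close>)

lemma poly_eval_cong:
  assumes "\<And>v. v \<in> vars p \<Longrightarrow> s v = t v"
  shows "poly_eval \<phi> s p = poly_eval \<phi> t p"
  unfolding poly_eval_def
proof (intro sum.cong prod.cong arg_cong2[of _ _ _ _ "(*)"] refl)
  fix u v assume "u \<in> Poly_Mapping.keys p" "v \<in> Poly_Mapping.keys u"
  then have "v \<in> vars p" by (auto simp: vars_def)
  then show "s v ^ Poly_Mapping.lookup u v = t v ^ Poly_Mapping.lookup u v" by (simp add: assms)
qed

lemma (in comm_ring_hom) hom_poly_eval:
  "hom (poly_eval \<phi> s p) = poly_eval (\<lambda>c. hom (\<phi> c)) (\<lambda>v. hom (s v)) p"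
  by (simp add: poly_eval_def hom_distribs)

context comm_ring_hom
begin

lemma poly_eval_zero: "poly_eval hom s 0 = 0"
  by (simp add: poly_eval_def)

lemma poly_eval_single: "poly_eval hom s (Poly_Mapping.single u c) = hom c * mono_eval s u"
  by (subst poly_eval_superset[of _ "{u}"]) auto

lemma poly_eval_add: "poly_eval hom s (p + q) = poly_eval hom s p + poly_eval hom s q"
proof -
  let ?S = "Poly_Mapping.keys p \<union> Poly_Mapping.keys q"
  show ?thesis
    by (simp add: poly_eval_superset[of _ ?S] subsetD[OF keys_add] subsetI lookup_add hom_distribs distrib_right sum.distrib
        Poly_Mapping.keys_add)
qed

lemma poly_eval_sum: "poly_eval hom s (sum f A) = (\<Sum>a\<in>A. poly_eval hom s (f a))"
  by (induction A rule: infinite_finite_induct) (simp_all add: poly_eval_zero poly_eval_add)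

lemma poly_eval_mult: "poly_eval hom s (p * q) = poly_eval hom s p * poly_eval hom s q"
proof -
  have "p * q = (\<Sum>u\<in>Poly_Mapping.keys p. Poly_Mapping.single u (Poly_Mapping.lookup p u)) *
      (\<Sum>w\<in>Poly_Mapping.keys q. Poly_Mapping.single w (Poly_Mapping.lookup q w))"
    by (simp flip: poly_mapping_sum_single)
  also have "\<dots> = (\<Sum>u\<in>Poly_Mapping.keys p. \<Sum>w\<in>Poly_Mapping.keys q.
      Poly_Mapping.single (u + w) (Poly_Mapping.lookup p u * Poly_Mapping.lookup q w))"
    by (simp add: sum_product mult_single)
  finally have "poly_eval hom s (p * q) = (\<Sum>u\<in>Poly_Mapping.keys p. \<Sum>w\<in>Poly_Mapping.keys q.
      hom (Poly_Mapping.lookup p u * Poly_Mapping.lookup q w) * mono_eval s (u + w))"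
    by (simp add: poly_eval_sum poly_eval_single)
  then show ?thesis
    unfolding poly_eval_mono_eval[of hom s p] poly_eval_mono_eval[of hom s q] sum_product
    by (simp add: hom_distribs mono_eval_add mult_ac)
qed

lemma comm_ring_hom_poly_eval: "comm_ring_hom (poly_eval hom s)"
proof
  show "poly_eval hom s 1 = 1"
    by (simp add: poly_eval_single flip: single_one)
qed (simp_all add: poly_eval_zero poly_eval_add poly_eval_mult)

lemma poly_eval_Var: "poly_eval hom s (Var v) = s v"
  by (simp add: Var_def poly_eval_single)

lemma poly_eval_Const: "poly_eval hom s (Const c) = hom c"
  by (simp add: Const_def poly_eval_single)

end

lemma comm_ring_hom_Const: "comm_ring_hom (Const :: 'k::comm_ring_1 \<Rightarrow> ('v \<Rightarrow>\<^sub>0 nat) \<Rightarrow>\<^sub>0 'k)"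
  by standard (simp_all add: Const_def single_add mult_single)

interpretation Const: comm_ring_hom Const
  by (rule comm_ring_hom_Const)

lemma Const_eq_0_iff: "Const c = 0 \<longleftrightarrow> c = 0"
  by (metis Const_def lookup_single_eq lookup_zero single_zero)

lemma mono_eval_Var: "mono_eval Var u = (Poly_Mapping.single u 1 :: ('v \<Rightarrow>\<^sub>0 nat) \<Rightarrow>\<^sub>0 'k::comm_ring_1)"
proof -
  have pow: "(Var v :: ('v \<Rightarrow>\<^sub>0 nat) \<Rightarrow>\<^sub>0 'k) ^ k = Poly_Mapping.single (Poly_Mapping.single v k) 1" for v k
    by (induction k) (simp_all add: Var_def mult_single flip: single_add)
  have "(\<Prod>v\<in>S. Poly_Mapping.single (f v) (1::'k)) = Poly_Mapping.single (\<Sum>v\<in>S. f v) 1"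
    for S :: "'v set" and f :: "'v \<Rightarrow> 'v \<Rightarrow>\<^sub>0 nat"
    by (induction S rule: infinite_finite_induct) (simp_all add: mult_single)
  then show ?thesis
    by (simp add: mono_eval_def pow flip: poly_mapping_sum_single)
qed

text \<open>Seeing coefficientwise application as the substitution of each variable for itself makes
  it a ring homomorphism without a separate computation with convolution products.\<close>

lemma poly_eval_Const_Var:
  "poly_eval (\<lambda>c. Const (\<phi> c)) Var p = Poly_Mapping.map \<phi> p"
  if "\<phi> 0 = 0" for \<phi> :: "'k::zero \<Rightarrow> 'l::comm_ring_1"
proof -
  have "poly_eval (\<lambda>c. Const (\<phi> c)) Var p =
      (\<Sum>u\<in>Poly_Mapping.keys p. Poly_Mapping.single u (\<phi> (Poly_Mapping.lookup p u)))"
    by (simp add: poly_eval_mono_eval mono_eval_Var Const_def mult_single)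
  also have "\<dots> = Poly_Mapping.map \<phi> p"
    using that by (intro poly_mapping_eqI)
      (auto simp: lookup_sum lookup_single when_def in_keys_iff Poly_Mapping.map.rep_eq)
  finally show ?thesis .
qed

lemma poly_eval_Const_Var_id: "poly_eval Const Var p = p"
  using poly_eval_Const_Var[of id p]
  by (simp add: poly_mapping_eqI Poly_Mapping.map.rep_eq when_def)

lemma comm_ring_hom_map: "comm_ring_hom (Poly_Mapping.map \<phi> :: (('v \<Rightarrow>\<^sub>0 nat) \<Rightarrow>\<^sub>0 'k) \<Rightarrow> _)"
  if "comm_ring_hom \<phi>" for \<phi> :: "'k::comm_ring_1 \<Rightarrow> 'l::comm_ring_1"
proof -
  interpret \<phi>: comm_ring_hom \<phi> by fact
  interpret C: comm_ring_hom "\<lambda>c. Const (\<phi> c) :: ('v \<Rightarrow>\<^sub>0 nat) \<Rightarrow>\<^sub>0 'l"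
    by standard (simp_all add: hom_distribs)
  have "Poly_Mapping.map \<phi> = (poly_eval (\<lambda>c. Const (\<phi> c)) Var :: (('v \<Rightarrow>\<^sub>0 nat) \<Rightarrow>\<^sub>0 'k) \<Rightarrow> _)"
    by (simp add: fun_eq_iff poly_eval_Const_Var)
  then show ?thesis
    using C.comm_ring_hom_poly_eval[of Var] by simp
qed

lemma poly_eval_map:
  assumes "\<phi> 0 = 0" "\<psi> 0 = 0"
  shows "poly_eval \<psi> s (Poly_Mapping.map \<phi> p) = poly_eval (\<lambda>c. \<psi> (\<phi> c)) s p"
proof -
  have "Poly_Mapping.keys (Poly_Mapping.map \<phi> p) \<subseteq> Poly_Mapping.keys p"
    by (auto simp: in_keys_iff Poly_Mapping.map.rep_eq)
  then show ?thesis using assms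
    by (subst poly_eval_superset[of _ "Poly_Mapping.keys p"]; simp?)
      (auto intro!: sum.cong simp: poly_eval_mono_eval Poly_Mapping.map.rep_eq in_keys_iff)
qed

lemma vars_map: "vars (Poly_Mapping.map \<phi> p) \<subseteq> vars p"
  by (fastforce simp: vars_def in_keys_iff Poly_Mapping.map.rep_eq)

lemma map_eq_0_iff:
  assumes "inj \<phi>" "\<phi> 0 = 0"
  shows "Poly_Mapping.map \<phi> p = 0 \<longleftrightarrow> p = 0"
proof -
  have "\<phi> x = 0 \<longleftrightarrow> x = 0" for x using assms by (metis injD)
  then show ?thesis by (auto simp: Poly_Mapping.map_eq_zero_iff in_keys_iff poly_mapping_eq_iff fun_eq_iff Poly_Mapping.map.rep_eq when_def)
qed

lemma vars_subset_add: "vars (p + q) \<subseteq> vars p \<union> vars q"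
  using keys_add[of p q] by (auto simp: vars_def)

lemma vars_subset_mult: "vars (p * q) \<subseteq> vars p \<union> vars (q :: ('v \<Rightarrow>\<^sub>0 nat) \<Rightarrow>\<^sub>0 'k::comm_ring_1)"
proof
  fix v assume "v \<in> vars (p * q)"
  then obtain a b where "a \<in> Poly_Mapping.keys p" "b \<in> Poly_Mapping.keys q" "v \<in> Poly_Mapping.keys (a + b)"
    using keys_mult[of p q] by (auto simp: vars_def)
  then show "v \<in> vars p \<union> vars q"
    using keys_add[of a b] by (auto simp: vars_def)
qed

lemma vars_Const [simp]: "vars (Const c) = {}"
  by (simp add: vars_def Const_def)

lemma vars_Var: "vars (Var v :: ('v \<Rightarrow>\<^sub>0 nat) \<Rightarrow>\<^sub>0 'k::comm_ring_1) = {v}"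
  by (simp add: vars_def Var_def)

lemma vars_uminus: "vars (- p) = vars (p :: ('v \<Rightarrow>\<^sub>0 nat) \<Rightarrow>\<^sub>0 'k::comm_ring_1)"
  by (simp add: vars_def)

section \<open>Polynomial functions\<close>

text \<open>Functions are used in place of polynomials so that determinants, matrix products and
  adjugates of polynomial matrices are polynomial by closure rules alone. The variables may form an
  infinite set, and the constants are arbitrary elements of the ring.\<close>

inductive polyfun :: "(('v \<Rightarrow> 'r) \<Rightarrow> 'r::comm_ring_1) \<Rightarrow> bool"
  where
    polyfun_const: "polyfun (\<lambda>s. c)"
  | polyfun_coord: "polyfun (\<lambda>s. s v)"
  | polyfun_add: "polyfun f \<Longrightarrow> polyfun g \<Longrightarrow> polyfun (\<lambda>s. f s + g s)"
  | polyfun_mult: "polyfun f \<Longrightarrow> polyfun g \<Longrightarrow> polyfun (\<lambda>s. f s * g s)"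

lemma polyfun_uminus: "polyfun f \<Longrightarrow> polyfun (\<lambda>s. - f s)"
  using polyfun_mult[OF polyfun_const[of "-1"], of f] by simp

lemma polyfun_diff: "polyfun f \<Longrightarrow> polyfun g \<Longrightarrow> polyfun (\<lambda>s. f s - g s)"
  using polyfun_add[OF _ polyfun_uminus, of f g] by simp

lemma polyfun_sum: "(\<And>a. a \<in> A \<Longrightarrow> polyfun (f a)) \<Longrightarrow> polyfun (\<lambda>s. \<Sum>a\<in>A. f a s)"
  by (induction A rule: infinite_finite_induct) (simp_all add: polyfun_const polyfun_add)

lemma polyfun_prod: "(\<And>a. a \<in> A \<Longrightarrow> polyfun (f a)) \<Longrightarrow> polyfun (\<lambda>s. \<Prod>a\<in>A. f a s)"
  by (induction A rule: infinite_finite_induct) (simp_all add: polyfun_const polyfun_mult)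

lemma polyfun_power: "polyfun f \<Longrightarrow> polyfun (\<lambda>s. f s ^ k)"
  by (induction k) (simp_all add: polyfun_const polyfun_mult)

lemma polyfun_poly_eval:
  assumes "\<And>v. v \<in> vars p \<Longrightarrow> polyfun (\<lambda>s. f s v)"
  shows "polyfun (\<lambda>s. poly_eval \<phi> (f s) p)"
  unfolding poly_eval_def
  using assms
  by (intro polyfun_sum polyfun_mult polyfun_const polyfun_prod polyfun_power) (auto simp: vars_def)

lemma polyfun_det:
  assumes "\<And>s. A s \<in> carrier_mat k k"
    and "\<And>i j. i < k \<Longrightarrow> j < k \<Longrightarrow> polyfun (\<lambda>s. A s $$ (i, j))"
  shows "polyfun (\<lambda>s. det (A s))"
  unfolding det_def'[OF assms(1)]
  by (intro polyfun_sum polyfun_mult polyfun_const polyfun_prod assms(2))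
    (auto simp: permutes_in_image)

lemma polyfun_mult_mat:
  assumes "\<And>s. A s \<in> carrier_mat n k" "\<And>s. B s \<in> carrier_mat k m"
    and "\<And>i j. i < n \<Longrightarrow> j < k \<Longrightarrow> polyfun (\<lambda>s. A s $$ (i, j))"
    and "\<And>i j. i < k \<Longrightarrow> j < m \<Longrightarrow> polyfun (\<lambda>s. B s $$ (i, j))"
    and "i < n" "j < m"
  shows "polyfun (\<lambda>s. (A s * B s) $$ (i, j))"
proof -
  have "(A s * B s) $$ (i, j) = (\<Sum>c = 0..<k. A s $$ (i, c) * B s $$ (c, j))" for s
    using assms(1,2)[of s] assms(5,6) by (auto simp: scalar_prod_def intro!: sum.cong)
  then show ?thesis
    using assms by (auto intro!: polyfun_sum polyfun_mult)
qed

text \<open>The adjugate is the polynomial substitute for the inverse; on unitriangular matrices,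
  whose determinant is 1, the two agree.\<close>

lemma polyfun_adj_mat:
  assumes "\<And>s. A s \<in> carrier_mat n n"
    and "\<And>i j. i < n \<Longrightarrow> j < n \<Longrightarrow> polyfun (\<lambda>s. A s $$ (i, j))"
    and "i < n" "j < n"
  shows "polyfun (\<lambda>s. adj_mat (A s) $$ (i, j))"
proof -
  have dims: "dim_row (A s) = n" "dim_col (A s) = n" for s
    using assms(1)[of s] by auto
  have "adj_mat (A s) $$ (i, j) = (- 1) ^ (j + i) * det (mat_delete (A s) j i)" for s
    using assms(3,4) by (simp add: adj_mat_def dims cofactor_def)
  moreover have "polyfun (\<lambda>s. det (mat_delete (A s) j i))"
    by (rule polyfun_det[where k = "n - 1"])
      (use assms(2-4) in \<open>auto simp: mat_delete_def dims intro!: assms(2)\<close>)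
  ultimately show ?thesis
    by (simp add: polyfun_mult polyfun_const)
qed

lemma polyfun_finite_support:
  assumes "polyfun f"
  obtains W where "finite W" "\<And>s t. (\<And>v. v \<in> W \<Longrightarrow> s v = t v) \<Longrightarrow> f s = f t"
proof -
  have "\<exists>W. finite W \<and> (\<forall>s t. (\<forall>v\<in>W. s v = t v) \<longrightarrow> f s = f t)"
    using assms
  proof induction
    case (polyfun_const c)
    then show ?case by blast
  next
    case (polyfun_coord v)
    then show ?case by (intro exI[of _ "{v}"]) simp
  next
    case (polyfun_add f g)
    then obtain W V where "finite W" "\<forall>s t. (\<forall>v\<in>W. s v = t v) \<longrightarrow> f s = f t"
      "finite V" "\<forall>s t. (\<forall>v\<in>V. s v = t v) \<longrightarrow> g s = g t" by blast
    then show ?case by (intro exI[of _ "W \<union> V"]) (metis UnCI finite_UnI)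
  next
    case (polyfun_mult f g)
    then obtain W V where "finite W" "\<forall>s t. (\<forall>v\<in>W. s v = t v) \<longrightarrow> f s = f t"
      "finite V" "\<forall>s t. (\<forall>v\<in>V. s v = t v) \<longrightarrow> g s = g t" by blast
    then show ?case by (intro exI[of _ "W \<union> V"]) (metis UnCI finite_UnI)
  qed
  then show ?thesis using that by metis
qed

lemma polyfun_upd_poly:
  assumes "polyfun f"
  shows "\<exists>q. \<forall>t. f (s(v := t)) = poly q t"
  using assms
proof induction
  case (polyfun_const c)
  then show ?case by (intro exI[of _ "[:c:]"]) simp
next
  case (polyfun_coord w)
  then show ?case
    by (intro exI[of _ "if w = v then [:0, 1:] else [:s w:]"]) simp
next
  case (polyfun_add f g)
  then show ?case by (metis poly_add)
next
  case (polyfun_mult f g)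
  then show ?case by (metis poly_mult)
qed

text \<open>A one-variable polynomial with infinitely many zeros is 0, so the coordinates can be
  released from \<open>S\<close> one at a time; finitely many releases suffice because
  \<open>f\<close> depends on finitely many coordinates.\<close>

lemma polyfun_vanish:
  fixes f :: "('v \<Rightarrow> 'r::idom) \<Rightarrow> 'r"
  assumes f: "polyfun f" and S: "infinite S" and van: "\<And>s. (\<And>v. s v \<in> S) \<Longrightarrow> f s = 0"
  shows "f s = 0"
proof -
  obtain W where W: "finite W" "\<And>s t. (\<And>v. v \<in> W \<Longrightarrow> s v = t v) \<Longrightarrow> f s = f t"
    using polyfun_finite_support[OF f] by blast
  \<comment> \<open>\<open>V\<close> is the finite set of coordinates already released.\<close>
  have "(\<And>v. v \<notin> V \<Longrightarrow> s v \<in> S) \<Longrightarrow> f s = 0" if "finite V" for V s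
    using that
  proof (induction V arbitrary: s)
    case empty
    then show ?case using van by blast
  next
    case (insert w V)
    obtain q where q: "\<And>t. f (s(w := t)) = poly q t"
      using polyfun_upd_poly[OF f] by metis
    have "poly q t = 0" if "t \<in> S" for t
      unfolding q[symmetric] using insert.prems that by (intro insert.IH) auto
    then have "infinite {t. poly q t = 0}"
      using S by (meson mem_Collect_eq rev_finite_subset subsetI)
    then have "q = 0" using poly_roots_finite by blast
    then show ?case using q[of "s w"] by simp
  qed
  note * = this
  obtain c where c: "c \<in> S" using S by fastforce
  \<comment> \<open>Outside the finite support \<open>W\<close> every coordinate is reset to a fixed
    element of \<open>S\<close>, so that only \<open>W\<close> is left to release.\<close>
  have "f s = f (\<lambda>v. if v \<in> W then s v else c)" by (rule W(2)) simp
  also have "\<dots> = 0" by (rule *[OF W(1)]) (simp add: c)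
  finally show ?thesis .
qed

section \<open>Minors and unitriangular matrices\<close>

text \<open>\<open>f q\<close> has exactly \<open>q\<close> predecessors in \<open>J\<close>, which
  is how \<open>pick\<close> enumerates a set.\<close>

lemma pick_eq:
  assumes mono: "strict_mono_on {..<k} f" and J: "J = f ` {..<k}" and q: "q < k"
  shows "pick J q = (f q :: nat)"
proof -
  have lt: "f p < f q \<longleftrightarrow> p < q" if "p < k" "q < k" for p q
    using mono that by (auto simp: strict_mono_on_less)
  have "{a \<in> J. a < f q} = f ` {..<q}"
    using q by (auto simp: J lt)
  moreover have "inj_on f {..<q}"
    by (rule inj_on_subset[OF strict_mono_on_imp_inj_on[OF mono]]) (use q in auto)
  ultimately have "card {a \<in> J. a < f q} = q"
    by (simp add: card_image)
  moreover have "f q \<in> J" using q J by blast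
  ultimately show ?thesis
    using pick_card_in_set[of "f q" J] by simp
qed

text \<open>Replaces the enumeration hidden in \<open>submatrix\<close> by explicit increasing index
  functions; \<open>Suc\<close> accounts for the 1-based sets \<open>R\<close> and
  \<open>C\<close>.\<close>

lemma minor_eq_det:
  assumes A: "A \<in> carrier_mat n n"
    and f: "strict_mono_on {..<k} f" "R = (\<lambda>p. Suc (f p)) ` {..<k}" "\<And>p. p < k \<Longrightarrow> f p < n"
    and g: "strict_mono_on {..<k} g" "C = (\<lambda>q. Suc (g q)) ` {..<k}" "\<And>q. q < k \<Longrightarrow> g q < n"
  shows "minor A R C = det (mat k k (\<lambda>(p, q). A $$ (f p, g q)))"
proof -
  have R: "{a. Suc a \<in> R} = f ` {..<k}" and C: "{b. Suc b \<in> C} = g ` {..<k}"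
    using f g by auto
  have "{i. i < n \<and> i \<in> f ` {..<k}} = f ` {..<k}" "{i. i < n \<and> i \<in> g ` {..<k}} = g ` {..<k}"
    using f g by auto
  moreover have "card (f ` {..<k}) = k" "card (g ` {..<k}) = k"
    using f g by (simp_all add: card_image strict_mono_on_imp_inj_on)
  ultimately have "submatrix A {a. Suc a \<in> R} {b. Suc b \<in> C} = mat k k (\<lambda>(p, q). A $$ (f p, g q))"
    unfolding submatrix_def R C using A
    by (intro cong_mat) (simp_all add: pick_eq[OF f(1)] pick_eq[OF g(1)])
  then show ?thesis by (simp add: minor_def)
qed

text \<open>One shape covers all minors of the problem: \<open>a = n - r\<close> with free
  \<open>b\<close> gives the minors \<open>M\<close>, \<open>b = r - 1\<close> with free
  \<open>a\<close> gives the minors \<open>N\<close>, and both choices together give the corner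
  minors \<open>D\<close>.\<close>

definition edge_mat :: "nat \<Rightarrow> 'r mat \<Rightarrow> nat \<Rightarrow> nat \<Rightarrow> nat \<Rightarrow> 'r mat"
  where "edge_mat n A r a b =
    mat r r (\<lambda>(p, q). A $$ (if p = 0 then a else n - r + p, if q = r - 1 then b else q))"

definition edge_minor :: "nat \<Rightarrow> 'r::comm_ring_1 mat \<Rightarrow> nat \<Rightarrow> nat \<Rightarrow> nat \<Rightarrow> 'r"
  where "edge_minor n A r a b = det (edge_mat n A r a b)"

definition corner_minor :: "nat \<Rightarrow> 'r::comm_ring_1 mat \<Rightarrow> nat \<Rightarrow> 'r"
  where "corner_minor n A r = det (mat r r (\<lambda>(p, q). A $$ (n - r + p, q)))"

lemma edge_mat_carrier [simp]: "edge_mat n A r a b \<in> carrier_mat r r"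
  by (simp add: edge_mat_def)

lemma edge_mat_dim [simp]: "dim_row (edge_mat n A r a b) = r" "dim_col (edge_mat n A r a b) = r"
  by (simp_all add: edge_mat_def)

lemma corner_minor_0 [simp]: "corner_minor n A 0 = 1"
  by (simp add: corner_minor_def det_dim_zero)

lemma edge_minor_corner: "edge_minor n A r (n - r) (r - 1) = corner_minor n A r"
  unfolding edge_minor_def edge_mat_def corner_minor_def
  by (intro arg_cong[of _ _ det] cong_mat) auto

context
  fixes n i :: nat
  assumes i: "1 \<le> i" "i \<le> n"
begin

lemma minorM_eq_edge:
  assumes A: "A \<in> carrier_mat n n" and j: "opp n i \<le> j" "j \<le> n"
  shows "minorM n i j A = edge_minor n A (opp n i) (i - 1) (j - 1)"
  unfolding minorM_def edge_minor_def edge_mat_def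
proof (rule minor_eq_det[OF A])
  let ?f = "\<lambda>p. if p = 0 then i - 1 else n - opp n i + p"
  let ?g = "\<lambda>q. if q = opp n i - 1 then j - 1 else q"
  show "strict_mono_on {..<opp n i} ?f" "strict_mono_on {..<opp n i} ?g"
    using i j by (auto simp: strict_mono_on_def opp_def)
  show "p < opp n i \<Longrightarrow> ?f p < n" "q < opp n i \<Longrightarrow> ?g q < n" for p q
    using i j by (auto simp: opp_def)
  show "{i..n} = (\<lambda>p. Suc (?f p)) ` {..<opp n i}"
  proof (intro equalityI subsetI)
    fix x assume "x \<in> {i..n}"
    then have "x = Suc (?f (x - i))" "x - i < opp n i" using i by (auto simp: opp_def)
    then show "x \<in> (\<lambda>p. Suc (?f p)) ` {..<opp n i}" by blast
  qed (use i in \<open>auto simp: opp_def\<close>)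
  show "{1..opp n i - 1} \<union> {j} = (\<lambda>q. Suc (?g q)) ` {..<opp n i}"
  proof (intro equalityI subsetI)
    fix x assume "x \<in> {1..opp n i - 1} \<union> {j}"
    then consider "x = j" | "1 \<le> x" "x \<le> opp n i - 1" by auto
    then have "\<exists>q<opp n i. x = Suc (?g q)"
    proof cases
      case 1
      then show ?thesis using i j by (intro exI[of _ "opp n i - 1"]) (auto simp: opp_def)
    next
      case 2
      then show ?thesis using i j by (intro exI[of _ "x - 1"]) (auto simp: opp_def)
    qed
    then show "x \<in> (\<lambda>q. Suc (?g q)) ` {..<opp n i}" by blast
  qed (use i j in \<open>auto simp: opp_def split: if_splits\<close>)
qed

lemma minorN_eq_edge:
  assumes A: "A \<in> carrier_mat n n" and j: "1 \<le> j" "j \<le> i"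
  shows "minorN n j i A = edge_minor n A (opp n i) (j - 1) (opp n i - 1)"
  unfolding minorN_def edge_minor_def edge_mat_def
proof (rule minor_eq_det[OF A])
  let ?f = "\<lambda>p. if p = 0 then j - 1 else n - opp n i + p"
  let ?g = "\<lambda>q. if q = opp n i - 1 then opp n i - 1 else q"
  show "strict_mono_on {..<opp n i} ?f" "strict_mono_on {..<opp n i} ?g"
    using i j by (auto simp: strict_mono_on_def opp_def)
  show "p < opp n i \<Longrightarrow> ?f p < n" "q < opp n i \<Longrightarrow> ?g q < n" for p q
    using i j by (auto simp: opp_def)
  show "{j} \<union> {i + 1..n} = (\<lambda>p. Suc (?f p)) ` {..<opp n i}"
  proof (intro equalityI subsetI)
    fix x assume "x \<in> {j} \<union> {i + 1..n}"
    then consider "x = j" | "i + 1 \<le> x" "x \<le> n" by auto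
    then have "\<exists>p<opp n i. x = Suc (?f p)"
    proof cases
      case 1
      then show ?thesis using i j by (intro exI[of _ 0]) (auto simp: opp_def)
    next
      case 2
      then show ?thesis using i j by (intro exI[of _ "x - i"]) (auto simp: opp_def)
    qed
    then show "x \<in> (\<lambda>p. Suc (?f p)) ` {..<opp n i}" by blast
  qed (use i j in \<open>auto simp: opp_def split: if_splits\<close>)
  show "{1..opp n i} = (\<lambda>q. Suc (?g q)) ` {..<opp n i}"
  proof (intro equalityI subsetI)
    fix x assume "x \<in> {1..opp n i}"
    then have "x = Suc (?g (x - 1))" "x - 1 < opp n i" by auto
    then show "x \<in> (\<lambda>q. Suc (?g q)) ` {..<opp n i}" by blast
  qed (auto split: if_splits)
qed

lemma polyD_eq_corner:
  assumes A: "A \<in> carrier_mat n n"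
  shows "polyD n i A = corner_minor n A (opp n i)"
  unfolding polyD_def corner_minor_def
proof (rule minor_eq_det[OF A])
  let ?f = "\<lambda>p. n - opp n i + p"
  show "strict_mono_on {..<opp n i} ?f" "strict_mono_on {..<opp n i} (\<lambda>q. q)"
    by (auto simp: strict_mono_on_def)
  show "p < opp n i \<Longrightarrow> ?f p < n" "q < opp n i \<Longrightarrow> q < n" for p q
    using i by (auto simp: opp_def)
  show "{i..n} = (\<lambda>p. Suc (?f p)) ` {..<opp n i}"
  proof (intro equalityI subsetI)
    fix x assume "x \<in> {i..n}"
    then have "x = Suc (?f (x - i))" "x - i < opp n i" using i by (auto simp: opp_def)
    then show "x \<in> (\<lambda>p. Suc (?f p)) ` {..<opp n i}" by blast
  qed (use i in \<open>auto simp: opp_def\<close>)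
  show "{1..opp n i} = Suc ` {..<opp n i}"
    by (auto simp: image_iff Suc_le_eq gr0_conv_Suc)
qed

end

text \<open>Columns \<open>b\<close> and \<open>r - 1\<close> of the matrix coincide. This is what
  makes \<open>Lmat\<close> triangular; the row version does the same for
  \<open>Nmat\<close>.\<close>

lemma edge_minor_eq_0_col:
  assumes "b < r - 1" shows "edge_minor n A r a b = 0"
proof -
  have "edge_mat n A r a b $$ (p, r - 1) = edge_mat n A r a b $$ (p, b)" if "p < r" for p
    using assms that by (simp add: edge_mat_def)
  then have "col (edge_mat n A r a b) b = col (edge_mat n A r a b) (r - 1)"
    using assms by (intro eq_vecI) auto
  then show ?thesis unfolding edge_minor_def
    using assms by (intro det_identical_columns[of _ r b "r - 1"]) auto
qed

lemma edge_minor_eq_0_row: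
  assumes "n - r < a" "a < n" "r \<le> n" shows "edge_minor n A r a b = 0"
proof -
  have "edge_mat n A r a b $$ (0, q) = edge_mat n A r a b $$ (a - (n - r), q)" if "q < r" for q
    using assms that by (simp add: edge_mat_def)
  then have "row (edge_mat n A r a b) 0 = row (edge_mat n A r a b) (a - (n - r))"
    using assms by (intro eq_vecI) auto
  then show ?thesis unfolding edge_minor_def
    using assms by (intro det_identical_rows[of _ r 0 "a - (n - r)"]) auto
qed

section \<open>Unitriangular matrices and their effect on edge minors\<close>

definition unitri :: "nat \<Rightarrow> 'r::comm_ring_1 mat \<Rightarrow> bool"
  where "unitri n u \<longleftrightarrow> u \<in> carrier_mat n n \<and>
    (\<forall>i<n. \<forall>j\<le>i. u $$ (i, j) = (if i = j then 1 else 0))"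

lemma unitriD:
  assumes "unitri n u"
  shows "u \<in> carrier_mat n n" "\<And>i j. i < n \<Longrightarrow> j < i \<Longrightarrow> u $$ (i, j) = 0"
    "\<And>i. i < n \<Longrightarrow> u $$ (i, i) = 1"
  using assms by (auto simp: unitri_def)

lemma det_unitri: "unitri n u \<Longrightarrow> det u = 1"
  using det_upper_triangular[of u n] unitriD[of n u]
  by (simp add: prod_list_diag_prod upper_triangular_def carrier_matD[of u n])

text \<open>Expand along the last column, the only one involving \<open>b\<close>. By triangularity
  of \<open>v\<close> the other columns of \<open>A * v\<close> combine only the first
  \<open>r - 1\<close> columns of \<open>A\<close>, through a block of determinant 1. So the
  cofactors are those of \<open>A\<close>, and what remains is linear in column \<open>b\<close> of
  \<open>v\<close>.\<close>

lemma edge_minor_mult_right: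
  assumes A: "A \<in> carrier_mat n n" and v: "unitri n v" and r: "1 \<le> r" "r \<le> n"
    and a: "a < n" and b: "b < n"
  shows "edge_minor n (A * v) r a b = (\<Sum>c<n. edge_minor n A r a c * v $$ (c, b))"
proof -
  note vD = unitriD[OF v]
  define rr where "rr p = (if p = 0 then a else n - r + p)" for p
  have rr: "rr p < n" if "p < r" for p using that r a by (auto simp: rr_def)
  have mult: "(A * v) $$ (x, y) = (\<Sum>c<n. A $$ (x, c) * v $$ (c, y))" if "x < n" "y < n" for x y
    using A vD(1) that by (auto simp: scalar_prod_def lessThan_atLeast0 intro!: sum.cong)
  define V where "V = mat (r - 1) (r - 1) (\<lambda>(p, q). v $$ (p, q))"
  have "det V = 1"
    by (rule det_unitri[of "r - 1"]) (use vD r in \<open>auto simp: V_def unitri_def\<close>)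
  \<comment> \<open>Deleting the last column removes all trace of \<open>b\<close> and
    \<open>c\<close>, hence \<open>c\<close> is arbitrary here; the summation index takes its place
    below.\<close>
  have cof: "cofactor (edge_mat n (A * v) r a b) p (r - 1) = cofactor (edge_mat n A r a c) p (r - 1)"
    if p: "p < r" for c p
  proof -
    have "mat_delete (edge_mat n (A * v) r a b) p (r - 1) = mat_delete (edge_mat n A r a c) p (r - 1) * V"
    proof (rule eq_matI)
      fix x y assume "x < dim_row (mat_delete (edge_mat n A r a c) p (r - 1) * V)"
        "y < dim_col (mat_delete (edge_mat n A r a c) p (r - 1) * V)"
      then have x: "x < r - 1" and y: "y < r - 1" by (auto simp: V_def)
      define x' where "x' = (if x < p then x else Suc x)"
      have x': "x' < r" using x p by (auto simp: x'_def)
      have "mat_delete (edge_mat n (A * v) r a b) p (r - 1) $$ (x, y) = (A * v) $$ (rr x', y)"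
        using x y p x' by (simp add: mat_delete_def edge_mat_def x'_def rr_def)
      also have "\<dots> = (\<Sum>z<n. A $$ (rr x', z) * v $$ (z, y))"
        using rr[OF x'] y r by (intro mult) auto
      also have "\<dots> = (\<Sum>z<r - 1. A $$ (rr x', z) * v $$ (z, y))"
        by (rule sum.mono_neutral_right) (use r y vD(2) in auto)
      also have "\<dots> = (\<Sum>z<r - 1. mat_delete (edge_mat n A r a c) p (r - 1) $$ (x, z) * V $$ (z, y))"
        by (rule sum.cong) (use x y p x' in \<open>simp_all add: mat_delete_def edge_mat_def x'_def rr_def V_def\<close>)
      also have "\<dots> = (mat_delete (edge_mat n A r a c) p (r - 1) * V) $$ (x, y)"
        using x y by (simp add: scalar_prod_def V_def lessThan_atLeast0)
      finally show "mat_delete (edge_mat n (A * v) r a b) p (r - 1) $$ (x, y)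
          = (mat_delete (edge_mat n A r a c) p (r - 1) * V) $$ (x, y)" .
    qed (simp_all add: V_def)
    note eq = this
    have "det (mat_delete (edge_mat n (A * v) r a b) p (r - 1)) = det (mat_delete (edge_mat n A r a c) p (r - 1)) * det V"
      unfolding eq by (rule det_mult[of _ "r - 1"]) (rule carrier_matI; simp add: V_def)+
    then show ?thesis
      unfolding cofactor_def by (simp only: \<open>det V = 1\<close> mult_1_right)
  qed
  have exp: "edge_minor n B r a d = (\<Sum>p<r. B $$ (rr p, d) * cofactor (edge_mat n B r a d) p (r - 1))"
    for B :: "'a mat" and d
    unfolding edge_minor_def using r
    by (subst laplace_expansion_column[of _ r "r - 1"]) (auto intro!: sum.cong simp: edge_mat_def rr_def)
  have "edge_minor n (A * v) r a b
      = (\<Sum>p<r. \<Sum>c<n. A $$ (rr p, c) * v $$ (c, b) * cofactor (edge_mat n A r a c) p (r - 1))"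
    unfolding exp
  proof (rule sum.cong[OF refl])
    fix p assume "p \<in> {..<r}"
    then have p: "p < r" by simp
    show "(A * v) $$ (rr p, b) * cofactor (edge_mat n (A * v) r a b) p (r - 1)
      = (\<Sum>c<n. A $$ (rr p, c) * v $$ (c, b) * cofactor (edge_mat n A r a c) p (r - 1))"
      unfolding mult[OF rr[OF p] b] sum_distrib_right
      by (intro sum.cong refl arg_cong2[of _ _ _ _ "(*)"] cof[OF p])
  qed
  also have "\<dots> = (\<Sum>c<n. edge_minor n A r a c * v $$ (c, b))"
    unfolding exp by (subst sum.swap) (simp add: sum_distrib_left sum_distrib_right mult_ac)
  finally show ?thesis .
qed

text \<open>Mirror image of right multiplication: expand along the first row. The remaining rows are
  the last \<open>r - 1\<close> rows, which \<open>u\<close> mixes among themselves by a block of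
  determinant 1.\<close>

lemma edge_minor_mult_left:
  assumes A: "A \<in> carrier_mat n n" and u: "unitri n u" and r: "1 \<le> r" "r \<le> n"
    and a: "a < n" and b: "b < n"
  shows "edge_minor n (u * A) r a b = (\<Sum>c<n. u $$ (a, c) * edge_minor n A r c b)"
proof -
  note uD = unitriD[OF u]
  define cc where "cc q = (if q = r - 1 then b else q)" for q
  have cc: "cc q < n" if "q < r" for q using that r b by (auto simp: cc_def)
  have mult: "(u * A) $$ (x, y) = (\<Sum>c<n. u $$ (x, c) * A $$ (c, y))" if "x < n" "y < n" for x y
    using A uD(1) that by (auto simp: scalar_prod_def lessThan_atLeast0 intro!: sum.cong)
  \<comment> \<open>The trailing block of \<open>u\<close>: \<open>Suc\<close> skips row
    \<open>n - r\<close>, whose place in the edge matrix is taken by the row expanded along.\<close>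
  define V where "V = mat (r - 1) (r - 1) (\<lambda>(p, q). u $$ (n - r + Suc p, n - r + Suc q))"
  have "det V = 1"
    by (rule det_unitri[of "r - 1"]) (use uD r in \<open>auto simp: V_def unitri_def\<close>)
  have cof: "cofactor (edge_mat n (u * A) r a b) 0 q = cofactor (edge_mat n A r c b) 0 q"
    if q: "q < r" for c q
  proof -
    have "mat_delete (edge_mat n (u * A) r a b) 0 q = V * mat_delete (edge_mat n A r c b) 0 q"
    proof (rule eq_matI)
      fix x y assume "x < dim_row (V * mat_delete (edge_mat n A r c b) 0 q)"
        "y < dim_col (V * mat_delete (edge_mat n A r c b) 0 q)"
      then have x: "x < r - 1" and y: "y < r - 1" by (auto simp: V_def)
      define y' where "y' = (if y < q then y else Suc y)"
      have y': "y' < r" using y q by (auto simp: y'_def)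
      have "mat_delete (edge_mat n (u * A) r a b) 0 q $$ (x, y) = (u * A) $$ (n - r + Suc x, cc y')"
        using x y q y' by (simp add: mat_delete_def edge_mat_def y'_def cc_def)
      also have "\<dots> = (\<Sum>z<n. u $$ (n - r + Suc x, z) * A $$ (z, cc y'))"
        using cc[OF y'] x r by (intro mult) auto
      also have "\<dots> = (\<Sum>z\<in>(\<lambda>w. n - r + Suc w) ` {..<r - 1}. u $$ (n - r + Suc x, z) * A $$ (z, cc y'))"
      proof (rule sum.mono_neutral_right)
        show "\<forall>z\<in>{..<n} - (\<lambda>w. n - r + Suc w) ` {..<r - 1}. u $$ (n - r + Suc x, z) * A $$ (z, cc y') = 0"
        proof
          fix z assume z: "z \<in> {..<n} - (\<lambda>w. n - r + Suc w) ` {..<r - 1}"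
          have "z \<le> n - r"
          proof (rule ccontr)
            assume "\<not> z \<le> n - r"
            then have "z = n - r + Suc (z - (n - r) - 1)" "z - (n - r) - 1 < r - 1"
              using z r by auto
            then show False using z by blast
          qed
          then show "u $$ (n - r + Suc x, z) * A $$ (z, cc y') = 0"
            using uD(2)[of "n - r + Suc x" z] x r by simp
        qed
      qed (use r in auto)
      also have "\<dots> = (\<Sum>w<r - 1. u $$ (n - r + Suc x, n - r + Suc w) * A $$ (n - r + Suc w, cc y'))"
        by (subst sum.reindex) (auto simp: inj_on_def)
      also have "\<dots> = (\<Sum>z<r - 1. V $$ (x, z) * mat_delete (edge_mat n A r c b) 0 q $$ (z, y))"
        by (rule sum.cong) (use x y q y' in \<open>simp_all add: mat_delete_def edge_mat_def y'_def cc_def V_def\<close>)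
      also have "\<dots> = (V * mat_delete (edge_mat n A r c b) 0 q) $$ (x, y)"
        using x y by (simp add: scalar_prod_def V_def lessThan_atLeast0)
      finally show "mat_delete (edge_mat n (u * A) r a b) 0 q $$ (x, y)
          = (V * mat_delete (edge_mat n A r c b) 0 q) $$ (x, y)" .
    qed (simp_all add: V_def)
    note eq = this
    have "det (mat_delete (edge_mat n (u * A) r a b) 0 q) = det V * det (mat_delete (edge_mat n A r c b) 0 q)"
      unfolding eq by (rule det_mult[of _ "r - 1"]) (rule carrier_matI; simp add: V_def)+
    then show ?thesis
      unfolding cofactor_def by (simp only: \<open>det V = 1\<close> mult_1_left)
  qed
  have exp: "edge_minor n B r d b = (\<Sum>q<r. B $$ (d, cc q) * cofactor (edge_mat n B r d b) 0 q)"
    for B :: "'a mat" and d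
    unfolding edge_minor_def using r
    by (subst laplace_expansion_row[of _ r 0]) (auto intro!: sum.cong simp: edge_mat_def cc_def)
  have "edge_minor n (u * A) r a b
      = (\<Sum>q<r. \<Sum>c<n. u $$ (a, c) * A $$ (c, cc q) * cofactor (edge_mat n A r c b) 0 q)"
    unfolding exp
  proof (rule sum.cong[OF refl])
    fix q assume "q \<in> {..<r}"
    then have q: "q < r" by simp
    show "(u * A) $$ (a, cc q) * cofactor (edge_mat n (u * A) r a b) 0 q
      = (\<Sum>c<n. u $$ (a, c) * A $$ (c, cc q) * cofactor (edge_mat n A r c b) 0 q)"
      unfolding mult[OF a cc[OF q]] sum_distrib_right
      by (intro sum.cong refl arg_cong2[of _ _ _ _ "(*)"] cof[OF q])
  qed
  also have "\<dots> = (\<Sum>c<n. u $$ (a, c) * edge_minor n A r c b)"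
    unfolding exp by (subst sum.swap) (simp add: sum_distrib_left mult_ac)
  finally show ?thesis .
qed

text \<open>Laplace expansion along the first row with the last column split off: deleting both
  leaves, up to sign, the corner minor of order \<open>r - 1\<close>.\<close>

lemma edge_minor_expand:
  assumes r: "1 \<le> r" "r \<le> n"
  shows "edge_minor n A r a b = A $$ (a, b) * ((- 1) ^ (r - 1) * corner_minor n A (r - 1)) +
    (\<Sum>q<r - 1. A $$ (a, q) * cofactor (edge_mat n A r a b) 0 q)"
proof -
  let ?G = "edge_mat n A r a b"
  have "mat_delete ?G 0 (r - 1) = mat (r - 1) (r - 1) (\<lambda>(p, q). A $$ (n - (r - 1) + p, q))"
    using r by (intro eq_matI) (auto simp: mat_delete_def edge_mat_def Suc_diff_le)
  then have cof: "cofactor ?G 0 (r - 1) = (- 1) ^ (r - 1) * corner_minor n A (r - 1)"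
    by (simp add: cofactor_def corner_minor_def)
  obtain k where k: "r = Suc k" using r by (cases r) auto
  have "edge_minor n A r a b = (\<Sum>q<r. ?G $$ (0, q) * cofactor ?G 0 q)"
    unfolding edge_minor_def using r by (intro laplace_expansion_row) auto
  also have "\<dots> = ?G $$ (0, r - 1) * cofactor ?G 0 (r - 1) + (\<Sum>q<r - 1. ?G $$ (0, q) * cofactor ?G 0 q)"
    by (simp add: k)
  also have "(\<Sum>q<r - 1. ?G $$ (0, q) * cofactor ?G 0 q) = (\<Sum>q<r - 1. A $$ (a, q) * cofactor ?G 0 q)"
    by (intro sum.cong refl) (simp add: edge_mat_def)
  also have "?G $$ (0, r - 1) = A $$ (a, b)"
    using r by (simp add: edge_mat_def)
  finally show ?thesis by (simp only: cof)
qed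

text \<open>In the order of the rows from the bottom up and of the columns from left to right,
  \<open>edge_val n A a b\<close> is affine in the entry \<open>(a, b)\<close>: the coefficient is, up to sign, a corner minor
  of earlier entries, and the constant term involves only earlier entries too. So the values
  \<open>edge_val\<close>, which are exactly the minors \<open>M\<^sub>i\<^sub>j\<close> and \<open>N\<^sub>j\<^sub>k\<close>, are coordinates on the set where the
  corner minors do not vanish.\<close>

definition edge_val :: "nat \<Rightarrow> 'r::comm_ring_1 mat \<Rightarrow> nat \<Rightarrow> nat \<Rightarrow> 'r"
  where "edge_val n A a b = edge_minor n A (min (n - a) (Suc b)) a b"

lemma edge_val_cong:
  assumes "a < n" "b < n"
    and "\<And>x y. x < n \<Longrightarrow> y < n \<Longrightarrow> a < x \<or> a = x \<and> y \<le> b \<Longrightarrow> A $$ (x, y) = A' $$ (x, y)"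
  shows "edge_val n A a b = edge_val n A' a b"
  unfolding edge_val_def edge_minor_def edge_mat_def
  by (intro arg_cong[of _ _ det] cong_mat refl) (auto intro!: assms(3) simp: assms(1,2), use assms(1,2) in linarith)

lemma corner_minor_eq_edge_val:
  assumes "1 \<le> r" "r \<le> n"
  shows "corner_minor n A r = edge_val n A (n - r) (r - 1)"
  using assms by (simp add: edge_val_def flip: edge_minor_corner)

lemma corner_minor_cong:
  assumes "r \<le> n" "\<And>x y. n - r \<le> x \<Longrightarrow> x < n \<Longrightarrow> y < n \<Longrightarrow> A $$ (x, y) = A' $$ (x, y)"
  shows "corner_minor n A r = corner_minor n A' r"
  unfolding corner_minor_def using assms(1)
  by (intro arg_cong[of _ _ det] cong_mat refl) (auto intro!: assms(2))

lemma edge_val_solve_entry: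
  fixes A :: "'f::field mat"
  assumes A: "A \<in> carrier_mat n n" and ab: "a < n" "b < n"
    and nz: "corner_minor n A (min (n - a) (Suc b) - 1) \<noteq> 0"
  obtains A' where "A' \<in> carrier_mat n n" "edge_val n A' a b = w"
    "\<And>x y. x < n \<Longrightarrow> y < n \<Longrightarrow> (x, y) \<noteq> (a, b) \<Longrightarrow> A' $$ (x, y) = A $$ (x, y)"
proof -
  define r where "r = min (n - a) (Suc b)"
  have r: "1 \<le> r" "r \<le> n" "r \<le> n - a" "r - 1 \<le> b" using ab by (auto simp: r_def)
  \<comment> \<open>\<open>B t\<close> is \<open>A\<close> with the unknown \<open>t\<close> in
    position \<open>(a, b)\<close>. The rows below \<open>a\<close> and the earlier entries of row
    \<open>a\<close>, hence \<open>s\<close> and \<open>rest\<close>, do not depend on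
    \<open>t\<close>.\<close>
  define B where "B t = mat n n (\<lambda>(x, y). if (x, y) = (a, b) then t else A $$ (x, y))" for t
  have B: "B t $$ (x, y) = A $$ (x, y)" if "x < n" "y < n" "(x, y) \<noteq> (a, b)" for x y t
    using that by (auto simp: B_def)
  define s where "s = (- 1) ^ (r - 1) * corner_minor n A (r - 1)"
  define rest where "rest = (\<Sum>q<r - 1. A $$ (a, q) * cofactor (edge_mat n A r a b) 0 q)"
  have "edge_val n (B t) a b = t * s + rest" for t
  proof -
    have 1: "corner_minor n (B t) (r - 1) = corner_minor n A (r - 1)"
      using ab r by (intro corner_minor_cong B) auto
    have "mat_delete (edge_mat n (B t) r a b) 0 q = mat_delete (edge_mat n A r a b) 0 q" for q
      using ab r by (intro eq_matI) (auto simp: mat_delete_def edge_mat_def intro!: B)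
    then have 2: "cofactor (edge_mat n (B t) r a b) 0 q = cofactor (edge_mat n A r a b) 0 q" for q
      by (simp add: cofactor_def)
    have 3: "(\<Sum>q<r - 1. B t $$ (a, q) * cofactor (edge_mat n A r a b) 0 q) = rest"
      unfolding rest_def using ab r by (intro sum.cong refl) (simp add: B)
    have "B t $$ (a, b) = t" using ab by (simp add: B_def)
    then show ?thesis
      unfolding edge_val_def r_def[symmetric] edge_minor_expand[OF r(1,2)] 1 2 3 s_def by simp
  qed
  moreover have "s \<noteq> 0" using nz by (simp add: s_def r_def)
  ultimately have "edge_val n (B ((w - rest) / s)) a b = w" by simp
  then show ?thesis
    by (intro that[of "B ((w - rest) / s)"] B) (simp_all add: B_def)
qed

text \<open>The entries are chosen one at a time in the order described above, each by solving its
  affine equation. The coefficient is a corner minor of rows already filled: either the empty minor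
  1 or one of the values that \<open>nz\<close> makes nonzero.\<close>

lemma edge_val_surj:
  fixes w :: "nat \<Rightarrow> nat \<Rightarrow> 'f::field"
  assumes nz: "\<And>r. 1 \<le> r \<Longrightarrow> r \<le> n \<Longrightarrow> w (n - r) (r - 1) \<noteq> 0"
  obtains A where "A \<in> carrier_mat n n" "\<And>a b. a < n \<Longrightarrow> b < n \<Longrightarrow> edge_val n A a b = w a b"
proof -
  have row: "\<exists>A\<in>carrier_mat n n. \<forall>a<n. \<forall>b<n. a0 < a \<or> a = a0 \<and> b < b0 \<longrightarrow> edge_val n A a b = w a b"
    if a0: "a0 < n" and A0: "A0 \<in> carrier_mat n n"
      "\<forall>a<n. \<forall>b<n. a0 < a \<longrightarrow> edge_val n A0 a b = w a b" and "b0 \<le> n" for a0 A0 b0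
    using \<open>b0 \<le> n\<close>
  proof (induction b0)
    case 0
    then show ?case using A0 by auto
  next
    case (Suc b0)
    then have b0: "b0 < n" by simp
    from Suc obtain A where A: "A \<in> carrier_mat n n"
      "\<And>a b. a < n \<Longrightarrow> b < n \<Longrightarrow> a0 < a \<or> a = a0 \<and> b < b0 \<Longrightarrow> edge_val n A a b = w a b"
      by auto
    define r where "r = min (n - a0) (Suc b0) - 1"
    \<comment> \<open>The order \<open>r\<close> is one less than that of the edge minor at
      \<open>(a0, b0)\<close>, so this corner minor lies strictly below row
      \<open>a0\<close>.\<close>
    have "corner_minor n A r \<noteq> 0"
    proof (cases "r = 0")
      case False
      then have r: "1 \<le> r" "r \<le> n" "a0 < n - r" "n - r < n" "r - 1 < n"
        using a0 b0 by (auto simp: r_def)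
      then have "corner_minor n A r = w (n - r) (r - 1)"
        by (simp add: corner_minor_eq_edge_val A(2))
      then show ?thesis using nz r by simp
    qed simp
    then obtain A' where A': "A' \<in> carrier_mat n n" "edge_val n A' a0 b0 = w a0 b0"
      "\<And>x y. x < n \<Longrightarrow> y < n \<Longrightarrow> (x, y) \<noteq> (a0, b0) \<Longrightarrow> A' $$ (x, y) = A $$ (x, y)"
      using edge_val_solve_entry[OF A(1) a0 b0] unfolding r_def by metis
    have "edge_val n A' a b = w a b" if "a < n" "b < n" "a0 < a \<or> a = a0 \<and> b < Suc b0" for a b
    proof (cases "a = a0 \<and> b = b0")
      case False
      then have "edge_val n A' a b = edge_val n A a b"
        using that by (intro edge_val_cong A') auto
      then show ?thesis using A(2) that False by (metis less_SucE)
    qed (use A'(2) in simp)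
    then show ?case using A'(1) by blast
  qed
  have "\<exists>A\<in>carrier_mat n n. \<forall>a<n. \<forall>b<n. n - d \<le> a \<longrightarrow> edge_val n A a b = w a b" if "d \<le> n" for d
    using that
  proof (induction d)
    case 0
    then show ?case by (intro bexI[of _ "0\<^sub>m n n"]) auto
  next
    case (Suc d)
    then obtain A0 where A0: "A0 \<in> carrier_mat n n" "\<forall>a<n. \<forall>b<n. n - d \<le> a \<longrightarrow> edge_val n A0 a b = w a b"
      by auto
    have "\<exists>A\<in>carrier_mat n n. \<forall>a<n. \<forall>b<n. n - Suc d < a \<or> a = n - Suc d \<and> b < n \<longrightarrow> edge_val n A a b = w a b"
      using Suc.prems A0 by (intro row[of _ A0 n]) auto
    then show ?case using Suc.prems by (metis le_neq_implies_less)
  qed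
  from this[of n] show ?thesis using that by auto
qed

section \<open>Subrings and subfields, and recovering a matrix over a subfield\<close>

lemma is_subfieldD:
  assumes "is_subfield F"
  shows "0 \<in> F" "1 \<in> F" "\<And>x y. x \<in> F \<Longrightarrow> y \<in> F \<Longrightarrow> x + y \<in> F" "\<And>x y. x \<in> F \<Longrightarrow> y \<in> F \<Longrightarrow> x * y \<in> F"
    "\<And>x. x \<in> F \<Longrightarrow> - x \<in> F" "\<And>x. x \<in> F \<Longrightarrow> inverse x \<in> F"
    "\<And>x y. x \<in> F \<Longrightarrow> y \<in> F \<Longrightarrow> x - y \<in> F" "\<And>x y. x \<in> F \<Longrightarrow> y \<in> F \<Longrightarrow> x / y \<in> F"
  using assms unfolding is_subfield_def
  by (blast+, metis diff_conv_add_uminus, metis divide_inverse)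

definition is_subring :: "'r::comm_ring_1 set \<Rightarrow> bool"
  where "is_subring S \<longleftrightarrow> 0 \<in> S \<and> 1 \<in> S \<and> (\<forall>x\<in>S. - x \<in> S) \<and>
    (\<forall>x\<in>S. \<forall>y\<in>S. x + y \<in> S \<and> x * y \<in> S)"

lemma is_subfield_imp_subring: "is_subfield F \<Longrightarrow> is_subring F"
  by (auto simp: is_subfield_def is_subring_def)

context
  fixes S :: "'r::comm_ring_1 set"
  assumes S: "is_subring S"
begin

lemma subring_add: "x \<in> S \<Longrightarrow> y \<in> S \<Longrightarrow> x + y \<in> S"
  and subring_mult: "x \<in> S \<Longrightarrow> y \<in> S \<Longrightarrow> x * y \<in> S"
  and subring_uminus: "x \<in> S \<Longrightarrow> - x \<in> S"
  and subring_0: "0 \<in> S" and subring_1: "1 \<in> S"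
  using S by (auto simp: is_subring_def)

lemma subring_sum: "(\<And>x. x \<in> A \<Longrightarrow> f x \<in> S) \<Longrightarrow> sum f A \<in> S"
  by (induction A rule: infinite_finite_induct) (auto intro: subring_0 subring_add)

lemma subring_prod: "(\<And>x. x \<in> A \<Longrightarrow> f x \<in> S) \<Longrightarrow> prod f A \<in> S"
  by (induction A rule: infinite_finite_induct) (auto intro: subring_1 subring_mult)

lemma subring_power: "x \<in> S \<Longrightarrow> x ^ k \<in> S"
  by (induction k) (auto intro: subring_1 subring_mult)

lemma subring_poly_eval:
  assumes "\<And>c. \<phi> c \<in> S" "\<And>v. v \<in> vars p \<Longrightarrow> s v \<in> S"
  shows "poly_eval \<phi> s p \<in> S"
  unfolding poly_eval_def using assms
  by (intro subring_sum subring_mult subring_prod subring_power) (auto simp: vars_def)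

lemma subring_det:
  assumes "A \<in> carrier_mat k k" "\<And>i j. i < k \<Longrightarrow> j < k \<Longrightarrow> A $$ (i, j) \<in> S"
  shows "det A \<in> S"
  unfolding det_def'[OF assms(1)]
proof (intro subring_sum subring_mult subring_prod)
  show "signof p \<in> S" for p
    by (auto simp: sign_def intro: subring_1 subring_uminus)
qed (auto intro!: assms(2) simp: permutes_in_image)

lemma subring_mult_mat:
  assumes "A \<in> carrier_mat n k" "B \<in> carrier_mat k m"
    and "\<And>i j. i < n \<Longrightarrow> j < k \<Longrightarrow> A $$ (i, j) \<in> S"
    and "\<And>i j. i < k \<Longrightarrow> j < m \<Longrightarrow> B $$ (i, j) \<in> S"
    and "i < n" "j < m"
  shows "(A * B) $$ (i, j) \<in> S"
proof -
  have "(A * B) $$ (i, j) = (\<Sum>c = 0..<k. A $$ (i, c) * B $$ (c, j))"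
    using assms(1,2,5,6) by (auto simp: scalar_prod_def intro!: sum.cong)
  then show ?thesis
    using assms by (auto intro!: subring_sum subring_mult)
qed

lemma subring_adj_mat:
  assumes "A \<in> carrier_mat n n" "\<And>i j. i < n \<Longrightarrow> j < n \<Longrightarrow> A $$ (i, j) \<in> S" "i < n" "j < n"
  shows "adj_mat A $$ (i, j) \<in> S"
proof -
  have dims: "dim_row A = n" "dim_col A = n"
    using assms(1) by auto
  have "adj_mat A $$ (i, j) = (- 1) ^ (j + i) * det (mat_delete A j i)"
    using assms(3,4) by (simp add: adj_mat_def dims cofactor_def)
  moreover have "det (mat_delete A j i) \<in> S"
    by (rule subring_det[where k = "n - 1"])
      (use assms(2-4) in \<open>auto simp: mat_delete_def dims intro!: assms(2)\<close>)
  ultimately show ?thesis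
    by (simp add: subring_mult subring_power subring_uminus subring_1)
qed

end

context
  fixes F :: "'f::field set"
  assumes F: "is_subfield F"
begin

text \<open>Going up the rows and from left to right in each row, the affine equation for the entry
  \<open>(a, b)\<close> has its coefficient, constant term and value in \<open>F\<close>, and the
  coefficient is nonzero.\<close>

lemma entries_in_subfield:
  assumes val: "\<And>a b. a < n \<Longrightarrow> b < n \<Longrightarrow> edge_val n A a b \<in> F"
    and nz: "\<And>r. r \<le> n \<Longrightarrow> corner_minor n A r \<noteq> 0"
    and "a < n" "b < n"
  shows "A $$ (a, b) \<in> F"
proof -
  have "a < n \<Longrightarrow> \<forall>b<n. A $$ (a, b) \<in> F" for a
  proof (induction "n - a" arbitrary: a rule: less_induct)
    case less
    have IH: "A $$ (x, y) \<in> F" if "a < x" "x < n" "y < n" for x y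
      using less(1)[of x] that by simp
    have "b < n \<Longrightarrow> A $$ (a, b) \<in> F" for b
    proof (induction b rule: less_induct)
      case (less b)
      have IH2: "A $$ (a, y) \<in> F" if "y < b" for y
        using less that by simp
      define r where "r = min (n - a) (Suc b)"
      have r: "1 \<le> r" "r \<le> n" "r \<le> n - a" "r - 1 \<le> b" using less(2) \<open>a < n\<close> by (auto simp: r_def)
      define s where "s = (- 1) ^ (r - 1) * corner_minor n A (r - 1)"
      define rest where "rest = (\<Sum>q<r - 1. A $$ (a, q) * cofactor (edge_mat n A r a b) 0 q)"
      have eq: "edge_val n A a b = A $$ (a, b) * s + rest"
        unfolding edge_val_def r_def[symmetric] edge_minor_expand[OF r(1,2)] s_def rest_def ..
      have "corner_minor n A (r - 1) \<in> F"
        unfolding corner_minor_def using r \<open>b < n\<close>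
        by (intro subring_det[OF is_subfield_imp_subring[OF F], of _ "r - 1"]) (auto intro!: IH)
      then have sF: "s \<in> F"
        unfolding s_def by (intro is_subfieldD[OF F] subring_power[OF is_subfield_imp_subring[OF F]])
      have "rest \<in> F" unfolding rest_def
      proof (intro subring_sum[OF is_subfield_imp_subring[OF F]] is_subfieldD(4)[OF F])
        fix q assume q: "q \<in> {..<r - 1}"
        show "A $$ (a, q) \<in> F" using q r by (intro IH2) auto
        have "det (mat_delete (edge_mat n A r a b) 0 q) \<in> F"
          using r q \<open>b < n\<close> by (intro subring_det[OF is_subfield_imp_subring[OF F], of _ "r - 1"])
            (auto simp: mat_delete_def edge_mat_def intro!: IH)
        then show "cofactor (edge_mat n A r a b) 0 q \<in> F"
          unfolding cofactor_def by (intro is_subfieldD[OF F] subring_power[OF is_subfield_imp_subring[OF F]])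
      qed
      moreover have "s \<noteq> 0" using nz[of "r - 1"] r by (simp add: s_def)
      ultimately have "A $$ (a, b) = (edge_val n A a b - rest) / s" by (simp add: eq)
      then show ?case
        using val[OF \<open>a < n\<close> \<open>b < n\<close>] sF \<open>rest \<in> F\<close> by (simp add: is_subfieldD[OF F])
    qed
    then show ?case by blast
  qed
  then show ?thesis using assms by blast
qed

end

text \<open>\<open>Lmat\<close> is the matrix of the minors \<open>M\<^sub>i\<^sub>j\<close> with its rows reversed, which makes it upper triangular.\<close>

definition Lmat :: "nat \<Rightarrow> 'r::comm_ring_1 mat \<Rightarrow> 'r mat"
  where "Lmat n A = mat n n (\<lambda>(a, b). edge_minor n A (Suc a) (n - Suc a) b)"

definition Nmat :: "nat \<Rightarrow> 'r::comm_ring_1 mat \<Rightarrow> 'r mat"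
  where "Nmat n A = mat n n (\<lambda>(a, c). edge_minor n A (n - c) a (n - Suc c))"

lemma Lmat_carrier [simp]: "Lmat n A \<in> carrier_mat n n" "dim_row (Lmat n A) = n" "dim_col (Lmat n A) = n"
  by (simp_all add: Lmat_def)

lemma Nmat_carrier [simp]: "Nmat n A \<in> carrier_mat n n" "dim_row (Nmat n A) = n" "dim_col (Nmat n A) = n"
  by (simp_all add: Nmat_def)

lemma Lmat_lower: "a < n \<Longrightarrow> b < a \<Longrightarrow> Lmat n A $$ (a, b) = 0"
  by (simp add: Lmat_def edge_minor_eq_0_col)

lemma Nmat_lower: "a < n \<Longrightarrow> c < a \<Longrightarrow> Nmat n A $$ (a, c) = 0"
  by (simp add: Nmat_def edge_minor_eq_0_row)

lemma Lmat_diag: "a < n \<Longrightarrow> Lmat n A $$ (a, a) = corner_minor n A (Suc a)"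
  using edge_minor_corner[of n A "Suc a"] by (simp add: Lmat_def)

lemma Nmat_diag: "c < n \<Longrightarrow> Nmat n A $$ (c, c) = corner_minor n A (n - c)"
  using edge_minor_corner[of n A "n - c"] by (simp add: Nmat_def)

text \<open>Positions on or past the antidiagonal belong to \<open>Lmat\<close>, those on or before
  it to \<open>Nmat\<close>, so the two matrices together hold all the coordinates
  \<open>edge_val\<close>; on the antidiagonal both give the same corner minor.\<close>

lemma edge_val_Lmat:
  assumes "a < n" "b < n" "n - Suc a \<le> b"
  shows "edge_val n A a b = Lmat n A $$ (n - Suc a, b)"
proof -
  have "min (n - a) (Suc b) = n - a" using assms by simp
  then show ?thesis using assms by (simp add: edge_val_def Lmat_def Suc_diff_Suc)
qed

lemma edge_val_Nmat:
  assumes "a < n" "b < n" "b \<le> n - Suc a"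
  shows "edge_val n A a b = Nmat n A $$ (a, n - Suc b)"
proof -
  have "min (n - a) (Suc b) = Suc b" using assms by simp
  then show ?thesis using assms by (simp add: edge_val_def Nmat_def Suc_diff_Suc)
qed

section \<open>Unitriangular products, and conjugation of \<open>Lmat\<close> and
  \<open>Nmat\<close>\<close>

lemma index_mult_mat_sum:
  assumes "A \<in> carrier_mat n k" "B \<in> carrier_mat k m" "i < n" "j < m"
  shows "(A * B) $$ (i, j) = (\<Sum>c<k. A $$ (i, c) * B $$ (c, j))"
  using assms by (auto simp: scalar_prod_def lessThan_atLeast0 intro!: sum.cong)

lemma unitri_mult:
  assumes "unitri n u" "unitri n v"
  shows "unitri n (u * v)"
proof -
  note u = unitriD[OF assms(1)] and v = unitriD[OF assms(2)]
  have "(u * v) $$ (i, j) = (if i = j then 1 else 0)" if "i < n" "j \<le> i" for i j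
  proof -
    have "(u * v) $$ (i, j) = (\<Sum>c<n. u $$ (i, c) * v $$ (c, j))"
      using u v that by (intro index_mult_mat_sum) auto
    also have "\<dots> = (\<Sum>c<n. if c = i then v $$ (i, j) else 0)"
    proof (intro sum.cong refl)
      fix c assume "c \<in> {..<n}"
      then show "u $$ (i, c) * v $$ (c, j) = (if c = i then v $$ (i, j) else 0)"
        using u(2)[of i c] u(3)[of i] v(2)[of c j] that by (cases c i rule: linorder_cases) auto
    qed
    also have "\<dots> = (if i = j then 1 else 0)"
      using that v(2)[of i j] v(3)[of i] by auto
    finally show ?thesis .
  qed
  then show ?thesis using u v by (auto simp: unitri_def)
qed

text \<open>Back substitution from the bottom row: in row \<open>i\<close> of \<open>u * v\<close>
  the terms with \<open>c < i\<close> vanish by \<open>u\<close>, those with \<open>c > i\<close> by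
  the rows of \<open>v\<close> already treated.\<close>

lemma unitri_right_inverse:
  assumes u: "unitri n u" and v: "v \<in> carrier_mat n n" and uv: "u * v = 1\<^sub>m n"
  shows "unitri n v"
proof -
  note uD = unitriD[OF u]
  have "i < n \<Longrightarrow> \<forall>j\<le>i. v $$ (i, j) = (if i = j then 1 else 0)" for i
  proof (induction "n - i" arbitrary: i rule: less_induct)
    case less
    show ?case
    proof (intro allI impI)
      fix j assume j: "j \<le> i"
      have "(1\<^sub>m n :: 'a mat) $$ (i, j) = (\<Sum>c<n. u $$ (i, c) * v $$ (c, j))"
        unfolding uv[symmetric] using uD v less(2) j by (intro index_mult_mat_sum) auto
      also have "\<dots> = (\<Sum>c<n. if c = i then v $$ (i, j) else 0)"
      proof (intro sum.cong refl)
        fix c assume "c \<in> {..<n}"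
        then show "u $$ (i, c) * v $$ (c, j) = (if c = i then v $$ (i, j) else 0)"
          using uD(2)[of i c] uD(3)[of i] less(1)[of c] less(2) j by (cases c i rule: linorder_cases) auto
      qed
      also have "\<dots> = v $$ (i, j)" using less(2) by simp
      finally show "v $$ (i, j) = (if i = j then 1 else 0)" using less(2) j by simp
    qed
  qed
  then show ?thesis using v by (simp add: unitri_def)
qed

lemma unitri_adj:
  assumes "unitri n u"
  shows "unitri n (adj_mat u)" "u * adj_mat u = 1\<^sub>m n" "adj_mat u * u = 1\<^sub>m n"
proof -
  have "1 \<cdot>\<^sub>m 1\<^sub>m n = (1\<^sub>m n :: 'a mat)" by (intro eq_matI) auto
  then show "u * adj_mat u = 1\<^sub>m n" "adj_mat u * u = 1\<^sub>m n"
    using adj_mat[OF unitriD(1)[OF assms]] by (simp_all add: det_unitri[OF assms])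
  then show "unitri n (adj_mat u)"
    using adj_mat[OF unitriD(1)[OF assms]] assms unitri_right_inverse by blast
qed

text \<open>Each entry is a minor on a full block of bottom rows. Left multiplication by
  \<open>u\<close> adds to the top row of this block only rows from below, and these give a repeated
  row; so only \<open>v\<close> acts, through the last column.\<close>

lemma Lmat_conj:
  assumes A: "A \<in> carrier_mat n n" and u: "unitri n u" and v: "unitri n v"
  shows "Lmat n (u * A * v) = Lmat n A * v"
proof (rule eq_matI)
  note uD = unitriD[OF u] and vD = unitriD[OF v]
  fix a b assume "a < dim_row (Lmat n A * v)" "b < dim_col (Lmat n A * v)"
  then have ab: "a < n" "b < n" using vD by auto
  have left: "edge_minor n (u * A) (Suc a) (n - Suc a) c = edge_minor n A (Suc a) (n - Suc a) c"
    if "c < n" for c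
  proof -
    have "edge_minor n (u * A) (Suc a) (n - Suc a) c
        = (\<Sum>d<n. u $$ (n - Suc a, d) * edge_minor n A (Suc a) d c)"
      using A u ab that by (intro edge_minor_mult_left) auto
    also have "\<dots> = (\<Sum>d<n. if d = n - Suc a then edge_minor n A (Suc a) (n - Suc a) c else 0)"
    proof (intro sum.cong refl)
      fix d assume "d \<in> {..<n}"
      then show "u $$ (n - Suc a, d) * edge_minor n A (Suc a) d c
          = (if d = n - Suc a then edge_minor n A (Suc a) (n - Suc a) c else 0)"
        using ab uD(2)[of "n - Suc a" d] uD(3)[of "n - Suc a"] edge_minor_eq_0_row[of n "Suc a" d A c]
        by (cases d "n - Suc a" rule: linorder_cases) auto
    qed
    finally show ?thesis using ab by simp
  qed
  have "Lmat n (u * A * v) $$ (a, b) = (\<Sum>c<n. edge_minor n (u * A) (Suc a) (n - Suc a) c * v $$ (c, b))"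
    using ab A uD v by (auto simp: Lmat_def intro!: edge_minor_mult_right)
  also have "\<dots> = (\<Sum>c<n. Lmat n A $$ (a, c) * v $$ (c, b))"
    using ab by (intro sum.cong refl) (simp add: left Lmat_def)
  also have "\<dots> = (Lmat n A * v) $$ (a, b)"
    using ab vD by (intro index_mult_mat_sum[symmetric, where n = n and m = n]) auto
  finally show "Lmat n (u * A * v) $$ (a, b) = (Lmat n A * v) $$ (a, b)" .
qed (use unitriD[OF v] in auto)

text \<open>Dual argument: \<open>v\<close> adds to the last column of the block only columns to its
  left, which are repeated, so only \<open>u\<close> acts, through the free row.\<close>

lemma Nmat_conj:
  assumes A: "A \<in> carrier_mat n n" and u: "unitri n u" and v: "unitri n v"
  shows "Nmat n (u * A * v) = u * Nmat n A"
proof (rule eq_matI)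
  note uD = unitriD[OF u] and vD = unitriD[OF v]
  fix a b assume "a < dim_row (u * Nmat n A)" "b < dim_col (u * Nmat n A)"
  then have ab: "a < n" "b < n" using uD by auto
  have right: "edge_minor n (A * v) (n - b) c (n - Suc b) = edge_minor n A (n - b) c (n - Suc b)"
    if "c < n" for c
  proof -
    have "edge_minor n (A * v) (n - b) c (n - Suc b)
        = (\<Sum>d<n. edge_minor n A (n - b) c d * v $$ (d, n - Suc b))"
      using A v ab that by (intro edge_minor_mult_right) auto
    also have "\<dots> = (\<Sum>d<n. if d = n - Suc b then edge_minor n A (n - b) c (n - Suc b) else 0)"
    proof (intro sum.cong refl)
      fix d assume "d \<in> {..<n}"
      then show "edge_minor n A (n - b) c d * v $$ (d, n - Suc b)
          = (if d = n - Suc b then edge_minor n A (n - b) c (n - Suc b) else 0)"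
        using ab vD(2)[of d "n - Suc b"] vD(3)[of "n - Suc b"] edge_minor_eq_0_col[of d "n - b" n A c]
        by (cases d "n - Suc b" rule: linorder_cases) auto
    qed
    finally show ?thesis using ab by simp
  qed
  have "u * A * v = u * (A * v)" using A uD vD by (intro assoc_mult_mat) auto
  then have "Nmat n (u * A * v) $$ (a, b) = (\<Sum>c<n. u $$ (a, c) * edge_minor n (A * v) (n - b) c (n - Suc b))"
    using ab A u vD by (auto simp: Nmat_def intro!: edge_minor_mult_left)
  also have "\<dots> = (\<Sum>c<n. u $$ (a, c) * Nmat n A $$ (c, b))"
    using ab by (intro sum.cong refl) (simp add: right Nmat_def)
  also have "\<dots> = (u * Nmat n A) $$ (a, b)"
    using ab uD by (intro index_mult_mat_sum[symmetric, where n = n and m = n]) auto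
  finally show "Nmat n (u * A * v) $$ (a, b) = (u * Nmat n A) $$ (a, b)" .
qed (use unitriD[OF u] in auto)

text \<open>The corner minors are the diagonal of the upper triangular \<open>Lmat\<close>, which a
  unitriangular right factor does not change.\<close>

lemma corner_minor_conj:
  assumes A: "A \<in> carrier_mat n n" and u: "unitri n u" and v: "unitri n v" and r: "r \<le> n"
  shows "corner_minor n (u * A * v) r = corner_minor n A r"
proof (cases r)
  case (Suc a)
  note vD = unitriD[OF v]
  have a: "a < n" using Suc r by simp
  have "corner_minor n (u * A * v) r = (\<Sum>c<n. Lmat n A $$ (a, c) * v $$ (c, a))"
    using a vD by (simp add: Suc Lmat_diag[symmetric] Lmat_conj[OF assms(1-3)] index_mult_mat_sum[of _ n n _ n] del: index_mult_mat)
  also have "\<dots> = (\<Sum>c<n. if c = a then Lmat n A $$ (a, a) else 0)"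
  proof (intro sum.cong refl)
    fix c assume "c \<in> {..<n}"
    then show "Lmat n A $$ (a, c) * v $$ (c, a) = (if c = a then Lmat n A $$ (a, a) else 0)"
      using a vD(2)[of c a] vD(3)[of a] Lmat_lower[of a n c A] by (cases c a rule: linorder_cases) auto
  qed
  also have "\<dots> = corner_minor n A r" using a by (simp add: Lmat_diag Suc)
  finally show ?thesis .
qed simp

text \<open>Triangularity of \<open>Lmat\<close> and \<open>Nmat\<close> confines the sum in the
  matrix product to the range from \<open>opp n i\<close> to \<open>k\<close>. The row index
  \<open>n - i\<close> comes from the reversal of the rows.\<close>

lemma polyP_eq:
  assumes A: "A \<in> carrier_mat n n" and B: "B \<in> carrier_mat n n"
    and i: "1 \<le> i" "i \<le> n" and k: "opp n i < k" "k \<le> n"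
  shows "polyP n i k A B = (Lmat n A * Nmat n B) $$ (n - i, k - 1)"
proof -
  have "polyP n i k A B = (\<Sum>j\<in>{opp n i..k}. Lmat n A $$ (n - i, j - 1) * Nmat n B $$ (j - 1, k - 1))"
    unfolding polyP_def
  proof (intro sum.cong refl)
    fix j assume "j \<in> {opp n i..k}"
    then have j: "opp n i \<le> j" "j \<le> k" by auto
    then have "1 \<le> j" by (auto simp: opp_def)
    then show "minorM n i j A * minorN n j k B = Lmat n A $$ (n - i, j - 1) * Nmat n B $$ (j - 1, k - 1)"
      using minorM_eq_edge[OF i A j(1)] minorN_eq_edge[OF _ _ B \<open>1 \<le> j\<close> j(2)] i k j
      by (simp add: Lmat_def Nmat_def opp_def Suc_diff_le)
  qed
  also have "\<dots> = (\<Sum>c\<in>{n - i..k - 1}. Lmat n A $$ (n - i, c) * Nmat n B $$ (c, k - 1))"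
    by (rule sum.reindex_bij_witness[of _ Suc "\<lambda>j. j - 1"]) (use i k in \<open>auto simp: opp_def\<close>)
  also have "\<dots> = (\<Sum>c<n. Lmat n A $$ (n - i, c) * Nmat n B $$ (c, k - 1))"
  proof (rule sum.mono_neutral_left)
    show "\<forall>c\<in>{..<n} - {n - i..k - 1}. Lmat n A $$ (n - i, c) * Nmat n B $$ (c, k - 1) = 0"
    proof
      fix c assume "c \<in> {..<n} - {n - i..k - 1}"
      then show "Lmat n A $$ (n - i, c) * Nmat n B $$ (c, k - 1) = 0"
        using i Lmat_lower[of "n - i" n c A] Nmat_lower[of c n "k - 1" B] by (cases "c < n - i") auto
    qed
  qed (use k in auto)
  also have "\<dots> = (Lmat n A * Nmat n B) $$ (n - i, k - 1)"
    using i k by (intro index_mult_mat_sum[symmetric, where n = n and m = n]) auto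
  finally show ?thesis .
qed

text \<open>The factors \<open>v\<close> and \<open>u\<close> meet in the middle and cancel: this is
  the invariance of the polynomials \<open>P\<close>.\<close>

lemma Lmat_Nmat_conj:
  assumes A: "A \<in> carrier_mat n n" and B: "B \<in> carrier_mat n n"
    and u: "unitri n u" and v: "unitri n v" and vu: "v * u = 1\<^sub>m n"
  shows "Lmat n (u * A * v) * Nmat n (u * B * v) = Lmat n A * Nmat n B"
proof -
  note uD = unitriD(1)[OF u] and vD = unitriD(1)[OF v]
  have "Lmat n (u * A * v) * Nmat n (u * B * v) = Lmat n A * (v * (u * Nmat n B))"
    unfolding Lmat_conj[OF A u v] Nmat_conj[OF B u v] using uD vD
    by (intro assoc_mult_mat[where ?n\<^sub>1 = n and ?n\<^sub>2 = n and ?n\<^sub>3 = n and ?n\<^sub>4 = n]) auto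
  also have "v * (u * Nmat n B) = v * u * Nmat n B" using uD vD
    by (intro assoc_mult_mat[symmetric, where ?n\<^sub>1 = n and ?n\<^sub>2 = n and ?n\<^sub>3 = n and ?n\<^sub>4 = n]) auto
  finally show ?thesis by (simp add: vu)
qed

section \<open>Fractions and the action on polynomials\<close>

lemma comm_ring_hom_to_fract: "comm_ring_hom (to_fract :: 'a::idom \<Rightarrow> 'a fract)"
  by standard simp_all

lemma Fract_eq_divide: "Fract p q = to_fract p / to_fract q"
  by (simp add: to_fract_def)

lemma scalar_eq: "scalar c = to_fract (Const c)"
  by (simp add: scalar_def to_fract_def)

lemma comm_ring_hom_scalar: "comm_ring_hom (scalar :: 'k::field \<Rightarrow> 'k pol fract)"
  by standard (simp_all add: scalar_eq Const.hom_add Const.hom_mult)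

interpretation to_fract: comm_ring_hom to_fract
  by (rule comm_ring_hom_to_fract)

interpretation scalar: comm_ring_hom scalar
  by (rule comm_ring_hom_scalar)

lemma scalar_eq_iff: "scalar c = (scalar d :: 'k::field pol fract) \<longleftrightarrow> c = d"
proof -
  have "scalar c = (scalar d :: 'k pol fract) \<longleftrightarrow> Const (c - d) = (0 :: 'k pol)"
    by (simp add: scalar_eq Const.hom_minus)
  then show ?thesis by (simp add: Const_eq_0_iff)
qed

lemma to_fract_poly_eval:
  "to_fract (poly_eval Const s p) = poly_eval scalar (\<lambda>v. to_fract (s v)) (p :: ('v \<Rightarrow>\<^sub>0 nat) \<Rightarrow>\<^sub>0 'k::field)"
  unfolding to_fract.hom_poly_eval scalar_eq[abs_def] ..

lemma poly_eval_scalar_Var: "poly_eval scalar (\<lambda>v. to_fract (Var v)) p = to_fract p"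
  by (simp add: poly_eval_Const_Var_id flip: to_fract_poly_eval)

text \<open>For an injective homomorphism on a whole domain the lift is an embedding of fraction
  fields; it extends base change of the coefficients to rational functions.\<close>

definition frac_map :: "('a::idom \<Rightarrow> 'b::idom) \<Rightarrow> 'a fract \<Rightarrow> 'b fract"
  where "frac_map = frac_lift UNIV"

context
  fixes h :: "'a::idom \<Rightarrow> 'b::idom"
  assumes h: "comm_ring_hom h" and inj: "\<And>x. x \<noteq> 0 \<Longrightarrow> h x \<noteq> 0"
begin

interpretation h: comm_ring_hom h by (rule h)

lemma frac_map_Fract: "q \<noteq> 0 \<Longrightarrow> frac_map h (Fract p q) = Fract (h p) (h q)"
  unfolding frac_map_def by (rule frac_lift_Fract) (simp_all add: h.hom_mult inj)

lemma frac_map_to_fract: "frac_map h (to_fract p) = to_fract (h p)"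
  by (simp add: to_fract_def frac_map_Fract)

lemma comm_ring_hom_frac_map: "comm_ring_hom (frac_map h)"
proof
  show "frac_map h (x + y) = frac_map h x + frac_map h y" for x y
    by (cases x; cases y) (simp add: frac_map_Fract h.hom_add h.hom_mult inj)
  show "frac_map h (x * y) = frac_map h x * frac_map h y" for x y
    by (cases x; cases y) (simp add: frac_map_Fract h.hom_mult inj)
  show "frac_map h 0 = 0" "frac_map h 1 = 1"
    using frac_map_to_fract[of 0] frac_map_to_fract[of 1] by simp_all
qed

lemma frac_map_eq_0: "frac_map h x = 0 \<Longrightarrow> x = 0"
  by (cases x) (use inj in \<open>auto simp: frac_map_Fract Zero_fract_def eq_fract\<close>)

end

section \<open>The coordinate ring, evaluation of the generators, and the action\<close>

lemma polyH_subring: "is_subring (polyH n m)"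
proof -
  have "vars (0 :: 'a pol) = {}" "vars (1 :: 'a pol) = {}"
    by (simp_all add: vars_def)
  then show ?thesis
    unfolding is_subring_def polyH_def mem_Collect_eq
    by (intro conjI ballI; simp add: vars_uminus)
      (meson le_sup_iff order_trans vars_subset_add vars_subset_mult)+
qed

lemma Const_in_polyH: "Const c \<in> polyH n m"
  by (simp add: polyH_def)

lemma Var_in_polyH: "l \<in> {1..m} \<Longrightarrow> i \<in> {1..n} \<Longrightarrow> j \<in> {1..n} \<Longrightarrow> Var (Coord l i j) \<in> polyH n m"
  by (simp add: polyH_def vars_Var)

lemma coord_mat_carrier [simp]: "coord_mat n l \<in> carrier_mat n n" "dim_row (coord_mat n l) = n"
  "dim_col (coord_mat n l) = n"
  by (simp_all add: coord_mat_def)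

lemma polyH_coord:
  assumes "p \<in> polyH n m" "v \<in> vars p"
  obtains l i j where "v = Coord l i j" "l \<in> {1..m}" "i \<in> {1..n}" "j \<in> {1..n}"
  using assms unfolding polyH_def by blast

text \<open>The tuple of matrices and the ring are left arbitrary so that homomorphisms, conjugation
  and specialisation can act on the tuple.\<close>

fun gen_val :: "nat \<Rightarrow> (nat \<Rightarrow> 'r::comm_ring_1 mat) \<Rightarrow> gen_index \<Rightarrow> 'r"
  where
    "gen_val n Xs (GenP1 l i k) = polyP n i k (Xs 1) (Xs l)"
  | "gen_val n Xs (GenP l i k) = polyP n i k (Xs l) (Xs l)"
  | "gen_val n Xs (GenD l k) = polyD n k (Xs l)"

lemma B_elem_eq_gen_val: "B_elem n b = gen_val n (coord_mat n) b"
  by (cases b) simp_all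

lemma B_index_cases:
  assumes "b \<in> B_index n m"
  obtains l i k where "b = GenP1 l i k" "2 \<le> l" "l \<le> m" "1 \<le> i" "i \<le> n" "opp n i < k" "k \<le> n"
  | l i k where "b = GenP l i k" "1 \<le> l" "l \<le> m" "1 \<le> i" "i \<le> n" "opp n i < k" "k \<le> n"
  | l k where "b = GenD l k" "1 \<le> l" "l \<le> m" "1 \<le> k" "k \<le> n"
  using assms unfolding B_index_def by fastforce

lemma (in comm_ring_hom) hom_minor: "hom (minor A R C) = minor (map_mat hom A) R C"
proof -
  have "map_mat hom (submatrix A I J) = submatrix (map_mat hom A) I J" for I J
    by (intro eq_matI) (auto simp: submatrix_def pick_le)
  then show ?thesis by (simp add: minor_def flip: hom_det)
qed

lemma (in comm_ring_hom) hom_gen_val: "hom (gen_val n Xs b) = gen_val n (\<lambda>l. map_mat hom (Xs l)) b"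
  by (cases b) (simp_all add: polyP_def polyD_def minorM_def minorN_def hom_minor hom_distribs)

lemma (in comm_ring_hom) hom_corner_minor:
  assumes "A \<in> carrier_mat n n" "r \<le> n"
  shows "hom (corner_minor n A r) = corner_minor n (map_mat hom A) r"
  unfolding corner_minor_def hom_det[symmetric] using assms
  by (intro arg_cong[of _ _ det] eq_matI) auto

lemma opp_range: "1 \<le> k \<Longrightarrow> k \<le> n \<Longrightarrow> opp n k \<le> n \<and> 1 \<le> opp n k"
  by (auto simp: opp_def)

lemma gen_val_conj:
  assumes Xs: "\<And>l. Xs l \<in> carrier_mat n n" and u: "unitri n u" and v: "unitri n v" and vu: "v * u = 1\<^sub>m n"
    and b: "b \<in> B_index n m"
  shows "gen_val n (\<lambda>l. u * Xs l * v) b = gen_val n Xs b"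
proof -
  have Y: "u * Xs l * v \<in> carrier_mat n n" for l
    using Xs unitriD(1)[OF u] unitriD(1)[OF v] by auto
  show ?thesis
    using b
    by (cases rule: B_index_cases)
      (simp_all add: polyP_eq[OF Y Y] polyP_eq[OF Xs Xs] Lmat_Nmat_conj[OF Xs Xs u v vu]
        polyD_eq_corner[OF _ _ Y] polyD_eq_corner[OF _ _ Xs] corner_minor_conj[OF Xs u v] opp_range)
qed

text \<open>The conjugated tuple as a point at which polynomials are evaluated. The intended inverse
  \<open>v\<close> is a separate argument, which makes the point polynomial in its data and
  compatible with ring homomorphisms.\<close>

definition conj_point :: "(nat \<Rightarrow> 'r::comm_ring_1 mat) \<Rightarrow> 'r mat \<Rightarrow> 'r mat \<Rightarrow> coord \<Rightarrow> 'r"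
  where "conj_point Xs u v = (\<lambda>c. case c of Coord l i j \<Rightarrow> (u * Xs l * v) $$ (i - 1, j - 1))"

lemma (in comm_ring_hom) hom_conj_point:
  assumes "u \<in> carrier_mat n n" "Xs l \<in> carrier_mat n n" "v \<in> carrier_mat n n"
    and "i \<in> {1..n}" "j \<in> {1..n}"
  shows "hom (conj_point Xs u v (Coord l i j))
    = conj_point (\<lambda>l. map_mat hom (Xs l)) (map_mat hom u) (map_mat hom v) (Coord l i j)"
proof -
  have "map_mat hom (u * Xs l * v) = map_mat hom u * map_mat hom (Xs l) * map_mat hom v"
    using assms by (simp add: mat_hom_mult[of _ n n _ n])
  moreover have "i - 1 < dim_row (u * Xs l * v)" "j - 1 < dim_col (u * Xs l * v)"
    using assms by auto
  ultimately show ?thesis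
    unfolding conj_point_def coord.case by (metis index_map_mat(1))
qed

lemma mat_inverse_unique:
  assumes "u \<in> carrier_mat n n" "v \<in> carrier_mat n n" "w \<in> carrier_mat n n"
    and "v * u = 1\<^sub>m n" "u * w = (1\<^sub>m n :: 'r::comm_ring_1 mat)"
  shows "v = w"
proof -
  have "v = v * (u * w)" using assms by simp
  also have "\<dots> = v * u * w" using assms by (intro assoc_mult_mat[symmetric]) auto
  finally show ?thesis using assms by simp
qed

lemma UT_iff_unitri: "g \<in> UT n \<longleftrightarrow> unitri n g"
  by (auto simp: UT_def unitri_def upper_triangular_def le_less)

lemma (in comm_ring_hom) map_mat_unitri: "unitri n u \<Longrightarrow> unitri n (map_mat hom u)"
  by (auto simp: unitri_def)

text \<open>Replaces the inverse taken in the ring of matrices by an explicit matrix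
  \<open>g\<close>, which stands on the left because \<open>rho n h\<close> conjugates by the
  inverse of \<open>h\<close>.\<close>

lemma rho_eq_conj_point:
  fixes g h :: "'k::field mat"
  assumes g: "unitri n g" and h: "unitri n h" and gh: "g * h = 1\<^sub>m n" "h * g = 1\<^sub>m n"
  shows "rho n h = poly_eval Const (conj_point (coord_mat n) (map_mat Const g) (map_mat Const h))"
proof -
  interpret R: ring "ring_mat TYPE('k) n ()" by (rule ring_mat)
  have "inv\<^bsub>ring_mat TYPE('k) n ()\<^esub> h = g"
    using unitriD(1)[OF g] unitriD(1)[OF h] gh
    by (intro R.inv_char) (auto simp: ring_mat_simps)
  note inv = this
  show ?thesis unfolding rho_def conj_point_def inv ..
qed

lemma conj_point_inverse:
  fixes u v :: "'r::comm_ring_1 mat"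
  assumes "Xs l \<in> carrier_mat n n" "u \<in> carrier_mat n n" "v \<in> carrier_mat n n"
    and "u * v = 1\<^sub>m n" "v * u = 1\<^sub>m n"
  shows "u * (v * Xs l * u) * v = Xs l"
proof -
  have "u * (v * Xs l * u) * v = u * v * Xs l * (u * v)"
    using assms(1-3) by (simp add: assoc_mult_mat[of _ n n _ n _ n])
  then show ?thesis
    using assms by simp
qed

context
  fixes n :: nat and g :: "'k::field mat"
  assumes g: "g \<in> UT n"
begin

lemma rho_eq: "rho n g = poly_eval Const (conj_point (coord_mat n) (map_mat Const (adj_mat g)) (map_mat Const g))"
  using g by (intro rho_eq_conj_point unitri_adj) (auto simp: UT_iff_unitri)

lemma comm_ring_hom_rho: "comm_ring_hom (rho n g)"
  unfolding rho_eq by (rule Const.comm_ring_hom_poly_eval)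

lemma map_mat_rho_coord_mat:
  "map_mat (rho n g) (coord_mat n l) = map_mat Const (adj_mat g) * coord_mat n l * map_mat Const g"
  using unitri_adj[of n g] g unitriD(1)[of n g] unitriD(1)[of n "adj_mat g"] unfolding rho_eq
  by (intro eq_matI) (auto simp: coord_mat_def Const.poly_eval_Var conj_point_def UT_iff_unitri)

text \<open>Substituting the inverse conjugation undoes \<open>rho n g\<close>. Only variables with
  indices in range come back: truncated subtraction identifies index 0 with index 1, which is why
  \<open>p\<close> is taken in \<open>polyH\<close>.\<close>

lemma rho_nonzero:
  assumes p: "p \<in> polyH n m" "p \<noteq> 0"
  shows "rho n g p \<noteq> 0"
proof
  assume 0: "rho n g p = 0"
  define h where "h = adj_mat g"
  have g': "unitri n g" using g by (simp add: UT_iff_unitri)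
  have h: "unitri n h" "g * h = 1\<^sub>m n" "h * g = 1\<^sub>m n"
    using unitri_adj[OF g'] by (simp_all add: h_def)
  have hU: "h \<in> UT n" using h by (simp add: UT_iff_unitri)
  define G H :: "'k pol mat" where "G = map_mat Const g" and "H = map_mat Const h"
  have GH: "G \<in> carrier_mat n n" "H \<in> carrier_mat n n" "G * H = 1\<^sub>m n" "H * G = 1\<^sub>m n"
    using unitriD(1)[OF g'] unitriD(1)[OF h(1)] h(2,3) unfolding G_def H_def
    by (auto simp flip: Const.mat_hom_mult simp: Const.mat_hom_one)
  define e where "e = poly_eval Const (conj_point (coord_mat n) G H)"
  interpret e: comm_ring_hom e
    unfolding e_def by (rule Const.comm_ring_hom_poly_eval)
  have e_coord: "map_mat e (coord_mat n l) = G * coord_mat n l * H" for l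
    unfolding e_def using GH
    by (intro eq_matI) (auto simp: coord_mat_def Const.poly_eval_Var conj_point_def)
  have "map_mat e H = H" "map_mat e G = G"
    unfolding G_def H_def using unitriD(1)[OF g'] unitriD(1)[OF h(1)]
    by (auto simp: e_def Const.poly_eval_Const)
  have "e (rho n g p) = poly_eval (\<lambda>c. e (Const c)) (\<lambda>v. e (conj_point (coord_mat n) H G v)) p"
    unfolding rho_eq e.hom_poly_eval by (simp add: H_def G_def h_def)
  also have "\<dots> = poly_eval Const Var p"
    unfolding e_def Const.poly_eval_Const
  proof (rule poly_eval_cong)
    fix v assume "v \<in> vars p"
    then obtain l i j where v: "v = Coord l i j" "i \<in> {1..n}" "j \<in> {1..n}"
      using polyH_coord[OF p(1)] by metis
    have "e (conj_point (coord_mat n) H G v) = conj_point (\<lambda>l. map_mat e (coord_mat n l)) H G v"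
      using e.hom_conj_point[of H n "coord_mat n" l G i j] GH v \<open>map_mat e H = H\<close> \<open>map_mat e G = G\<close>
      by simp
    also have "\<dots> = coord_mat n l $$ (i - 1, j - 1)"
      unfolding conj_point_def v coord.case e_coord
      by (simp only: conj_point_inverse[where Xs = "coord_mat n", OF coord_mat_carrier(1) GH(2,1,4,3)])
    also have "\<dots> = Var v" using v by (auto simp: coord_mat_def)
    finally show "poly_eval Const (conj_point (coord_mat n) G H) (conj_point (coord_mat n) H G v) = Var v"
      by (simp add: e_def)
  qed
  finally have "e (rho n g p) = p" by (simp add: poly_eval_Const_Var_id)
  then show False using 0 p(2) by simp
qed

end

section \<open>The field of invariants\<close>

text \<open>If the submatrix is not square, \<open>det\<close> is 0, which also lies in
  \<open>S\<close>; hence the unfolding of \<open>det_def\<close>.\<close>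

lemma minor_in_subring:
  assumes S: "is_subring S" and A: "A \<in> carrier_mat n n"
    and "\<And>i j. i < n \<Longrightarrow> j < n \<Longrightarrow> A $$ (i, j) \<in> S"
  shows "minor A R C \<in> S"
  unfolding minor_def det_def
  using assms(3) A
  by (auto intro!: subring_sum[OF S] subring_mult[OF S] subring_prod[OF S] subring_0[OF S] simp: subring_1[OF S]
      subring_uminus[OF S] sign_def submatrix_def pick_le permutes_in_image)

lemma B_elem_in_polyH:
  assumes "b \<in> B_index n m" "1 \<le> m"
  shows "B_elem n b \<in> polyH n m"
proof -
  have "minor (coord_mat n l) R C \<in> polyH n m" if "l \<in> {1..m}" for l R C
    by (rule minor_in_subring[OF polyH_subring coord_mat_carrier(1)])
      (use that in \<open>auto simp: coord_mat_def intro!: Var_in_polyH\<close>)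
  then show ?thesis
    using assms by (cases rule: B_index_cases[OF assms(1)])
      (auto simp: polyP_def polyD_def minorM_def minorN_def intro!: subring_sum[OF polyH_subring] subring_mult[OF polyH_subring])
qed

lemma rho_B_elem:
  assumes g: "g \<in> UT n" and b: "b \<in> B_index n m"
  shows "rho n g (B_elem n b) = (B_elem n b :: 'k::field pol)"
proof -
  interpret r: comm_ring_hom "rho n g" by (rule comm_ring_hom_rho[OF g])
  have u: "unitri n g" using g by (simp add: UT_iff_unitri)
  have "map_mat Const g * map_mat Const (adj_mat g) = (1\<^sub>m n :: 'k pol mat)"
    using unitriD(1)[OF u] unitriD(1)[OF unitri_adj(1)[OF u]] unitri_adj(2)[OF u]
    by (simp flip: Const.mat_hom_mult[of _ n n _ n] add: Const.mat_hom_one)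
  then show ?thesis
    unfolding B_elem_eq_gen_val r.hom_gen_val map_mat_rho_coord_mat[OF g]
    using u b by (intro gen_val_conj[where m = m] Const.map_mat_unitri unitri_adj) auto
qed

section \<open>Invariants over an extension field, descended to the base field\<close>

abbreviation (input) base_change :: "('k::zero \<Rightarrow> 'l::zero) \<Rightarrow> 'k pol \<Rightarrow> 'l pol"
  where "base_change \<equiv> Poly_Mapping.map"

text \<open>Covers both notions of invariants: the embedding into the algebraic closure gives
  \<open>alg_invariants\<close>, the identity gives \<open>invariants\<close>.\<close>

definition descended_invariants :: "('k::field \<Rightarrow> 'l::field) \<Rightarrow> nat \<Rightarrow> nat \<Rightarrow> 'k pol fract set"
  where "descended_invariants \<iota> n m =
    {f \<in> ratH n m. frac_lift (polyH n m) (Poly_Mapping.map \<iota>) f \<in> invariants n m}"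

context
  fixes \<iota> :: "'k::field \<Rightarrow> 'l::field"
  assumes hom: "comm_ring_hom \<iota>" and inj: "inj \<iota>"
begin

interpretation \<iota>: comm_ring_hom \<iota> by (rule hom)

interpretation bc: comm_ring_hom "base_change \<iota>"
  by (rule comm_ring_hom_map[OF hom])

lemma map_nonzero: "p \<noteq> 0 \<Longrightarrow> base_change \<iota> p \<noteq> 0"
  by (simp add: map_eq_0_iff[OF inj])

lemma map_in_polyH: "p \<in> polyH n m \<Longrightarrow> base_change \<iota> p \<in> polyH n m"
  using vars_map[of \<iota> p] by (auto simp: polyH_def)

lemma map_Var: "base_change \<iota> (Var v) = Var v"
  by (simp add: Var_def)

lemma map_Const: "base_change \<iota> (Const c) = Const (\<iota> c)"
  by (simp add: Const_def)

lemma map_mat_map_coord_mat: "map_mat (base_change \<iota>) (coord_mat n l) = coord_mat n l"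
  by (intro eq_matI) (auto simp: coord_mat_def map_Var)

text \<open>Clearing denominators turns invariance of a fraction into a polynomial identity, in
  which closure under the field operations can be checked. This rests on \<open>rho\<close> and base
  change sending no denominator to 0.\<close>

lemma Fract_in_descended_invariants_iff:
  assumes pq: "p \<in> polyH n m" "q \<in> polyH n m" "q \<noteq> 0"
  shows "Fract p q \<in> descended_invariants \<iota> n m \<longleftrightarrow>
    (\<forall>g\<in>UT n. rho n g (base_change \<iota> p) * base_change \<iota> q = base_change \<iota> p * rho n g (base_change \<iota> q))"
proof -
  have "frac_lift (polyH n m) (base_change \<iota>) (Fract p q) = Fract (base_change \<iota> p) (base_change \<iota> q)"
    using pq by (intro frac_lift_Fract bc.hom_mult map_nonzero) auto
  moreover have "Fract p q \<in> ratH n m" "Fract (base_change \<iota> p) (base_change \<iota> q) \<in> ratH n m"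
    using pq map_in_polyH map_nonzero unfolding ratH_def by blast+
  moreover have "frac_lift (polyH n m) (rho n g) (Fract (base_change \<iota> p) (base_change \<iota> q)) = Fract (base_change \<iota> p) (base_change \<iota> q) \<longleftrightarrow>
      rho n g (base_change \<iota> p) * base_change \<iota> q = base_change \<iota> p * rho n g (base_change \<iota> q)" if g: "g \<in> UT n" for g
  proof -
    interpret r: comm_ring_hom "rho n g" by (rule comm_ring_hom_rho[OF g])
    have nz: "rho n g (base_change \<iota> q) \<noteq> 0" "base_change \<iota> q \<noteq> 0"
      using pq map_in_polyH map_nonzero rho_nonzero[OF g] by blast+
    have "frac_lift (polyH n m) (rho n g) (Fract (base_change \<iota> p) (base_change \<iota> q)) = Fract (rho n g (base_change \<iota> p)) (rho n g (base_change \<iota> q))"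
      using pq map_in_polyH map_nonzero rho_nonzero[OF g] by (intro frac_lift_Fract r.hom_mult) auto
    then show ?thesis using nz by (simp add: eq_fract)
  qed
  ultimately show ?thesis
    by (simp add: descended_invariants_def invariants_def)
qed

lemma descended_invariants_obtain:
  assumes "f \<in> descended_invariants \<iota> n m"
  obtains p q where "f = Fract p q" "p \<in> polyH n m" "q \<in> polyH n m" "q \<noteq> 0"
    "\<And>g. g \<in> UT n \<Longrightarrow> rho n g (base_change \<iota> p) * base_change \<iota> q = base_change \<iota> p * rho n g (base_change \<iota> q)"
proof -
  from assms obtain p q where pq: "f = Fract p q" "p \<in> polyH n m" "q \<in> polyH n m" "q \<noteq> 0"
    by (auto simp: descended_invariants_def ratH_def)
  with assms Fract_in_descended_invariants_iff[OF pq(2-4)] show ?thesis by (intro that[OF pq]) auto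
qed

lemma Fract_1_in_descended_invariants:
  assumes "p \<in> polyH n m" "\<And>g. g \<in> UT n \<Longrightarrow> rho n g (base_change \<iota> p) = base_change \<iota> p"
  shows "Fract p 1 \<in> descended_invariants \<iota> n m"
proof (subst Fract_in_descended_invariants_iff; (intro ballI)?)
  fix g :: "'l mat" assume g: "g \<in> UT n"
  interpret r: comm_ring_hom "rho n g" by (rule comm_ring_hom_rho[OF g])
  show "rho n g (base_change \<iota> p) * base_change \<iota> 1 = base_change \<iota> p * rho n g (base_change \<iota> 1)"
    by (simp add: assms(2)[OF g])
qed (use assms subring_1[OF polyH_subring] in auto)

lemma scalar_in_descended_invariants: "scalar c \<in> descended_invariants \<iota> n m"
  unfolding scalar_def
  by (rule Fract_1_in_descended_invariants[OF Const_in_polyH]) (simp add: map_Const rho_eq Const.poly_eval_Const)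

lemma is_subfield_descended_invariants: "is_subfield (descended_invariants \<iota> n m)"
  unfolding is_subfield_def
proof (intro conjI ballI)
  note R = subring_add[OF polyH_subring] subring_mult[OF polyH_subring] subring_uminus[OF polyH_subring]
    subring_0[OF polyH_subring] subring_1[OF polyH_subring]
  let ?I = "descended_invariants \<iota> n m"
  show 0: "0 \<in> ?I" and "1 \<in> ?I"
    using scalar_in_descended_invariants[of 0] scalar_in_descended_invariants[of 1] by simp_all
  fix x assume "x \<in> ?I"
  then obtain p q where x: "x = Fract p q" "p \<in> polyH n m" "q \<in> polyH n m" "q \<noteq> 0"
    "\<And>g. g \<in> UT n \<Longrightarrow> rho n g (base_change \<iota> p) * base_change \<iota> q = base_change \<iota> p * rho n g (base_change \<iota> q)"
    by (rule descended_invariants_obtain) blast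
  have "Fract (- p) q \<in> ?I"
  proof (subst Fract_in_descended_invariants_iff; (intro ballI)?)
    fix g :: "'l mat" assume g: "g \<in> UT n"
    interpret r: comm_ring_hom "rho n g" by (rule comm_ring_hom_rho[OF g])
    show "rho n g (base_change \<iota> (- p)) * base_change \<iota> q = base_change \<iota> (- p) * rho n g (base_change \<iota> q)"
      by (simp add: bc.hom_uminus r.hom_uminus x(5)[OF g])
  qed (use x in \<open>auto simp: R\<close>)
  then show "- x \<in> ?I" by (simp add: x)
  show "inverse x \<in> ?I"
  proof (cases "p = 0")
    case True
    then show ?thesis using 0 by (simp add: x fract_collapse)
  next
    case False
    then have "Fract q p \<in> ?I"
      using x by (subst Fract_in_descended_invariants_iff) (auto simp: mult.commute)
    then show ?thesis by (simp add: x)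
  qed
  fix y assume "y \<in> ?I"
  then obtain p' q' where y: "y = Fract p' q'" "p' \<in> polyH n m" "q' \<in> polyH n m" "q' \<noteq> 0"
    "\<And>g. g \<in> UT n \<Longrightarrow> rho n g (base_change \<iota> p') * base_change \<iota> q' = base_change \<iota> p' * rho n g (base_change \<iota> q')"
    by (rule descended_invariants_obtain) blast
  have "Fract (p * p') (q * q') \<in> ?I"
  proof (subst Fract_in_descended_invariants_iff; (intro ballI)?)
    fix g :: "'l mat" assume g: "g \<in> UT n"
    interpret r: comm_ring_hom "rho n g" by (rule comm_ring_hom_rho[OF g])
    have "rho n g (base_change \<iota> (p * p')) * base_change \<iota> (q * q') = (rho n g (base_change \<iota> p) * base_change \<iota> q) * (rho n g (base_change \<iota> p') * base_change \<iota> q')"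
      by (simp add: bc.hom_mult r.hom_mult mult_ac)
    also have "\<dots> = base_change \<iota> (p * p') * rho n g (base_change \<iota> (q * q'))"
      unfolding x(5)[OF g] y(5)[OF g] by (simp add: bc.hom_mult r.hom_mult mult_ac)
    finally show "rho n g (base_change \<iota> (p * p')) * base_change \<iota> (q * q') = base_change \<iota> (p * p') * rho n g (base_change \<iota> (q * q'))" .
  qed (use x y in \<open>auto simp: R\<close>)
  then show "x * y \<in> ?I" by (simp add: x y)
  have "Fract (p * q' + p' * q) (q * q') \<in> ?I"
  proof (subst Fract_in_descended_invariants_iff; (intro ballI)?)
    fix g :: "'l mat" assume g: "g \<in> UT n"
    interpret r: comm_ring_hom "rho n g" by (rule comm_ring_hom_rho[OF g])
    have "rho n g (base_change \<iota> (p * q' + p' * q)) * base_change \<iota> (q * q')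
        = (rho n g (base_change \<iota> p) * base_change \<iota> q) * (rho n g (base_change \<iota> q') * base_change \<iota> q') + (rho n g (base_change \<iota> p') * base_change \<iota> q') * (rho n g (base_change \<iota> q) * base_change \<iota> q)"
      by (simp add: bc.hom_mult r.hom_mult bc.hom_add r.hom_add algebra_simps)
    also have "\<dots> = base_change \<iota> (p * q' + p' * q) * rho n g (base_change \<iota> (q * q'))"
      unfolding x(5)[OF g] y(5)[OF g]
      by (simp add: bc.hom_mult r.hom_mult bc.hom_add r.hom_add algebra_simps)
    finally show "rho n g (base_change \<iota> (p * q' + p' * q)) * base_change \<iota> (q * q') = base_change \<iota> (p * q' + p' * q) * rho n g (base_change \<iota> (q * q'))" .
  qed (use x y in \<open>auto simp: R\<close>)
  then show "x + y \<in> ?I" using x y by simp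
qed

lemma field_generated_subset_descended_invariants:
  assumes m: "1 \<le> m"
  shows "field_generated (range scalar \<union> (\<lambda>b. Fract (B_elem n b) 1) ` B_index n m) \<subseteq> descended_invariants \<iota> n m"
proof -
  have "Fract (B_elem n b) 1 \<in> descended_invariants \<iota> n m" if b: "b \<in> B_index n m" for b
  proof (rule Fract_1_in_descended_invariants[OF B_elem_in_polyH[OF b m]])
    \<comment> \<open>The generators are built from the variables by ring operations alone, so base
      change gives the same expression over \<open>'l\<close>.\<close>
    have "base_change \<iota> (B_elem n b) = B_elem n b"
      unfolding B_elem_eq_gen_val bc.hom_gen_val map_mat_map_coord_mat ..
    then show "g \<in> UT n \<Longrightarrow> rho n g (base_change \<iota> (B_elem n b)) = base_change \<iota> (B_elem n b)" for g
      using rho_B_elem[OF _ b] by simp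
  qed
  then show ?thesis
    unfolding field_generated_def
    by (intro Inter_lower) (auto simp: is_subfield_descended_invariants scalar_in_descended_invariants)
qed

end

section \<open>Algebraic independence\<close>

text \<open>Arranged for solving for \<open>L\<close> column by column from the left.\<close>

lemma mult_upper_triangular_col:
  assumes L: "L \<in> carrier_mat n n" and N: "N \<in> carrier_mat n n"
    and low: "\<And>b c. b < n \<Longrightarrow> c < b \<Longrightarrow> N $$ (b, c) = 0" and "a < n" "c < n"
  shows "(L * N) $$ (a, c) = L $$ (a, c) * N $$ (c, c) + (\<Sum>b<c. L $$ (a, b) * N $$ (b, c))"
proof -
  have "(L * N) $$ (a, c) = (\<Sum>b<n. L $$ (a, b) * N $$ (b, c))"
    using assms by (intro index_mult_mat_sum) auto
  also have "\<dots> = (\<Sum>b<Suc c. L $$ (a, b) * N $$ (b, c))"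
    by (rule sum.mono_neutral_right) (use assms in auto)
  finally show ?thesis by (simp add: add.commute)
qed

text \<open>Take \<open>Q\<close> times the inverse of \<open>N\<close>, written with the adjugate;
  its triangularity follows column by column from \<open>L * N = Q\<close>.\<close>

lemma upper_triangular_right_divide:
  fixes N Q :: "'f::field mat"
  assumes N: "N \<in> carrier_mat n n" and Q: "Q \<in> carrier_mat n n"
    and lowN: "\<And>b c. b < n \<Longrightarrow> c < b \<Longrightarrow> N $$ (b, c) = 0"
    and diag: "\<And>c. c < n \<Longrightarrow> N $$ (c, c) \<noteq> 0"
    and lowQ: "\<And>b c. b < n \<Longrightarrow> c < b \<Longrightarrow> Q $$ (b, c) = 0"
  obtains L where "L \<in> carrier_mat n n" "L * N = Q" "\<And>b c. b < n \<Longrightarrow> c < b \<Longrightarrow> L $$ (b, c) = 0"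
proof -
  have "det N = prod_list (diag_mat N)"
    using N by (intro det_upper_triangular) (auto simp: upper_triangular_def lowN)
  also have "\<dots> \<noteq> 0" using N diag by (auto simp: prod_list_zero_iff diag_mat_def)
  finally have det: "det N \<noteq> 0" .
  define L where "L = inverse (det N) \<cdot>\<^sub>m (Q * adj_mat N)"
  have L: "L \<in> carrier_mat n n" using N Q adj_mat[OF N] by (simp add: L_def)
  have "L * N = inverse (det N) \<cdot>\<^sub>m (Q * adj_mat N * N)"
    unfolding L_def using N Q adj_mat(1)[OF N] by (intro mult_smult_assoc_mat) auto
  also have "Q * adj_mat N * N = Q * (det N \<cdot>\<^sub>m 1\<^sub>m n)"
    using N Q adj_mat[OF N] by (simp add: assoc_mult_mat[of _ n n _ n _ n])
  also have "\<dots> = det N \<cdot>\<^sub>m Q"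
    using Q by (subst mult_smult_distrib[of _ n n _ n]) auto
  also have "inverse (det N) \<cdot>\<^sub>m (det N \<cdot>\<^sub>m Q) = Q"
    using det Q by (intro eq_matI) auto
  finally have LN: "L * N = Q" .
  have "c < b \<Longrightarrow> L $$ (b, c) = 0" if b: "b < n" for b c
  proof (induction c rule: less_induct)
    case (less c)
    have "0 = L $$ (b, c) * N $$ (c, c) + (\<Sum>d<c. L $$ (b, d) * N $$ (d, c))"
      using mult_upper_triangular_col[OF L N lowN b, of c] less(2) b lowQ[of b c] by (simp add: LN)
    also have "(\<Sum>d<c. L $$ (b, d) * N $$ (d, c)) = 0"
      using less by (intro sum.neutral) auto
    finally show ?case using diag[of c] less(2) b by simp
  qed
  then show ?thesis using that L LN by blast
qed

text \<open>The point is found on the slice where \<open>Lmat\<close> of the first matrix is diagonal.\<close>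

lemma gen_val_surj:
  fixes t :: "gen_index \<Rightarrow> 'f::field"
  assumes nz: "\<And>l k. t (GenD l k) \<noteq> 0"
  obtains Y where "\<And>l. Y l \<in> carrier_mat n n" "\<And>b. b \<in> B_index n m \<Longrightarrow> gen_val n Y b = t b"
proof -
  \<comment> \<open>A corner minor of order \<open>r\<close> is \<open>D_k\<close> with
    \<open>k = n - r + 1\<close>.\<close>
  define d where "d l r = t (GenD l (n - r + 1))" for l r
  \<comment> \<open>On the slice, \<open>Lmat\<close> of the first matrix is diagonal with entries
    \<open>d 1 (Suc a)\<close>, so \<open>P_ik\<close> of the first and the \<open>l\<close>-th
    matrix is \<open>d 1 (Suc a)\<close> times an entry of \<open>Nmat\<close>; solve for that
    entry. Here \<open>i = n - a\<close> and \<open>k = c + 1\<close>, and for \<open>l = 1\<close>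
    the role of \<open>GenP1\<close> is played by \<open>GenP 1\<close>.\<close>
  define N where "N l = mat n n (\<lambda>(a, c). if a = c then d l (n - c) else if a < c then
      (if l = 1 then t (GenP 1 (n - a) (c + 1)) else t (GenP1 l (n - a) (c + 1))) / d 1 (Suc a) else 0)" for l
  \<comment> \<open>The product of \<open>Lmat\<close> and \<open>Nmat\<close> to be attained; its
    diagonal is forced by the corner minors on the diagonals of the two factors.\<close>
  define Q where "Q l = mat n n (\<lambda>(a, c). if a = c then d l (Suc a) * d l (n - c) else if a < c then
      t (GenP l (n - a) (c + 1)) else 0)" for l
  have d: "d l r \<noteq> 0" for l r by (simp add: d_def nz)
  have "\<exists>L \<in> carrier_mat n n. L * N l = Q l \<and> (\<forall>b<n. \<forall>c<b. L $$ (b, c) = 0) \<and>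
      (l = 1 \<longrightarrow> (\<forall>b<n. \<forall>c<n. L $$ (b, c) = (if b = c then d 1 (Suc b) else 0)))" for l
  proof (cases "l = 1")
    case True
    define L where "L = mat n n (\<lambda>(b, c). if b = c then d 1 (Suc b) else 0)"
    have L: "L \<in> carrier_mat n n" by (simp add: L_def)
    have N: "N l \<in> carrier_mat n n" by (simp add: N_def)
    have "L * N l = Q l"
    proof (rule eq_matI)
      fix a c assume "a < dim_row (Q l)" "c < dim_col (Q l)"
      then have ac: "a < n" "c < n" by (auto simp: Q_def)
      have "(L * N l) $$ (a, c) = (\<Sum>b<n. L $$ (a, b) * N l $$ (b, c))"
        using ac L N by (intro index_mult_mat_sum) auto
      also have "\<dots> = (\<Sum>b<n. if b = a then d 1 (Suc a) * N l $$ (a, c) else 0)"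
        using ac by (intro sum.cong refl) (simp add: L_def)
      also have "\<dots> = Q l $$ (a, c)"
        using ac d True by (simp add: N_def Q_def)
      finally show "(L * N l) $$ (a, c) = Q l $$ (a, c)" .
    qed (simp_all add: L_def N_def Q_def)
    then show ?thesis by (intro bexI[OF _ L]) (auto simp: L_def)
  next
    case False
    obtain L where "L \<in> carrier_mat n n" "L * N l = Q l" "\<And>b c. b < n \<Longrightarrow> c < b \<Longrightarrow> L $$ (b, c) = 0"
      by (rule upper_triangular_right_divide[of "N l" n "Q l"]) (auto simp: N_def Q_def d)
    then show ?thesis using False by blast
  qed
  then obtain L where L: "\<And>l. L l \<in> carrier_mat n n" "\<And>l. L l * N l = Q l"
      "\<And>l b c. b < n \<Longrightarrow> c < b \<Longrightarrow> L l $$ (b, c) = 0"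
      "\<And>b c. b < n \<Longrightarrow> c < n \<Longrightarrow> L 1 $$ (b, c) = (if b = c then d 1 (Suc b) else 0)"
    by metis
  have N: "N l \<in> carrier_mat n n" for l by (simp add: N_def)
  \<comment> \<open>The diagonals of \<open>L l\<close> and \<open>N l\<close> list the values of
    \<open>d l\<close> in opposite orders; this compatibility lets both come from one
    matrix.\<close>
  have diag: "L l $$ (a, a) = d l (Suc a)" if a: "a < n" for l a
  proof -
    have "L l $$ (a, a) * N l $$ (a, a) = Q l $$ (a, a)"
      using mult_upper_triangular_col[OF L(1) N _ a a, of l l] a L(3)[OF a]
      by (simp add: L(2)) (simp add: N_def)
    then show ?thesis using a d by (simp add: N_def Q_def)
  qed
  have "\<exists>A\<in>carrier_mat n n. \<forall>a<n. \<forall>b<n. edge_val n A a b =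
      (if n - Suc a \<le> b then L l $$ (n - Suc a, b) else N l $$ (a, n - Suc b))" for l
  proof -
    have "(if n - Suc (n - r) \<le> r - 1 then L l $$ (n - Suc (n - r), r - 1)
        else N l $$ (n - r, n - Suc (r - 1))) \<noteq> 0" if "1 \<le> r" "r \<le> n" for r
    proof -
      have "n - Suc (n - r) = r - 1" using that by auto
      then show ?thesis using that by (simp add: diag d)
    qed
    from edge_val_surj[of n "\<lambda>a b. if n - Suc a \<le> b then L l $$ (n - Suc a, b) else N l $$ (a, n - Suc b)", OF this]
    show ?thesis by metis
  qed
  then obtain Y where Y: "\<And>l. Y l \<in> carrier_mat n n" and val: "\<And>l a b. a < n \<Longrightarrow> b < n \<Longrightarrow> edge_val n (Y l) a b =
      (if n - Suc a \<le> b then L l $$ (n - Suc a, b) else N l $$ (a, n - Suc b))"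
    by metis
  have Lmat: "Lmat n (Y l) = L l" for l
  proof (rule eq_matI)
    fix a b assume "a < dim_row (L l)" "b < dim_col (L l)"
    then have ab: "a < n" "b < n" using L(1)[of l] by auto
    show "Lmat n (Y l) $$ (a, b) = L l $$ (a, b)"
    proof (cases "a \<le> b")
      case True
      then show ?thesis
        using edge_val_Lmat[of "n - Suc a" n b "Y l"] val[of "n - Suc a" b l] ab by (simp add: Suc_diff_Suc)
    next
      case False
      then show ?thesis using ab L(3) by (simp add: Lmat_lower)
    qed
  qed (use L(1)[of l] in auto)
  have Nmat: "Nmat n (Y l) = N l" for l
  proof (rule eq_matI)
    fix a c assume "a < dim_row (N l)" "c < dim_col (N l)"
    then have ac: "a < n" "c < n" using N[of l] by auto
    show "Nmat n (Y l) $$ (a, c) = N l $$ (a, c)"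
    proof (cases a c rule: linorder_cases)
      case less
      then have "n - Suc (n - Suc c) = c" "n - Suc c \<le> n - Suc a" "\<not> n - Suc a \<le> n - Suc c"
        using ac by auto
      then show ?thesis
        using edge_val_Nmat[of a n "n - Suc c" "Y l"] val[of a "n - Suc c" l] ac by simp
    next
      case equal
      then show ?thesis
        using edge_val_Nmat[of a n "n - Suc c" "Y l"] val[of a "n - Suc c" l] ac diag[of "n - Suc a" l]
        by (auto simp: Suc_diff_Suc N_def)
    next
      case greater
      then show ?thesis using ac by (simp add: Nmat_lower N_def)
    qed
  qed (use N[of l] in auto)
  have "gen_val n Y b = t b" if "b \<in> B_index n m" for b
    using that
  proof (cases rule: B_index_cases)
    case (1 l i k)
    then have "i = n - (n - i)" "n - i < n" "k - 1 < n" "n - i < k - 1" by (auto simp: opp_def)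
    moreover have "(L 1 * N l) $$ (n - i, k - 1) = d 1 (Suc (n - i)) * N l $$ (n - i, k - 1)"
    proof -
      have "(L 1 * N l) $$ (n - i, k - 1) = (\<Sum>b<n. L 1 $$ (n - i, b) * N l $$ (b, k - 1))"
        using 1 by (intro index_mult_mat_sum[OF L(1) N]) (auto simp: opp_def)
      also have "\<dots> = (\<Sum>b<n. if b = n - i then d 1 (Suc (n - i)) * N l $$ (n - i, k - 1) else 0)"
        using 1 by (intro sum.cong refl) (simp add: L(4)[unfolded One_nat_def])
      finally show ?thesis using 1 by simp
    qed
    ultimately show ?thesis
      using 1 d by (simp add: polyP_eq[OF Y Y] Lmat Nmat) (simp add: N_def)
  next
    case (2 l i k)
    then have "n - i < n" "k - 1 < n" "n - i < k - 1" by (auto simp: opp_def)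
    then show ?thesis
      using 2 by (simp add: polyP_eq[OF Y Y] Lmat Nmat L(2)) (simp add: Q_def)
  next
    case (3 l k)
    have "corner_minor n (Y l) (opp n k) = Lmat n (Y l) $$ (n - k, n - k)"
      using 3 by (simp add: Lmat_diag opp_def)
    then show ?thesis
      using 3 by (simp add: polyD_eq_corner[OF _ _ Y] Lmat diag d_def)
  qed
  then show ?thesis using Y that by blast
qed

lemma coord_hom_eval:
  fixes Y :: "nat \<Rightarrow> 'k::field pol fract mat"
  assumes Y: "\<And>l. Y l \<in> carrier_mat n n"
  defines "h \<equiv> poly_eval scalar (\<lambda>c. case c of Coord l i j \<Rightarrow> Y l $$ (i - 1, j - 1))"
  shows "comm_ring_hom h" "map_mat h (coord_mat n l) = Y l"
proof -
  show "comm_ring_hom h"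
    unfolding h_def by (rule scalar.comm_ring_hom_poly_eval)
  show "map_mat h (coord_mat n l) = Y l"
    unfolding h_def using Y[of l] by (intro eq_matI) (auto simp: coord_mat_def scalar.poly_eval_Var)
qed

text \<open>The independent values for the generators have to live in \<open>'k pol fract\<close>,
  whose variables are of type \<open>coord\<close>. The residue modulo 3 of the first index keeps
  the three kinds of generators apart.\<close>

fun gen_coord :: "gen_index \<Rightarrow> coord"
  where
    "gen_coord (GenP1 l i k) = Coord (3 * l) i k"
  | "gen_coord (GenP l i k) = Coord (3 * l + 1) i k"
  | "gen_coord (GenD l k) = Coord (3 * l + 2) k 0"

lemma inj_gen_coord: "inj gen_coord"
proof (rule injI)
  show "gen_coord x = gen_coord y \<Longrightarrow> x = y" for x y
    by (cases x; cases y; simp; presburger)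
qed

text \<open>Renaming back along the inverse of \<open>f\<close> recovers \<open>p\<close>.\<close>

lemma rename_injective:
  fixes p :: "('i \<Rightarrow>\<^sub>0 nat) \<Rightarrow>\<^sub>0 'k::comm_ring_1"
  assumes "inj f" "poly_eval Const (\<lambda>b. Var (f b)) p = (0 :: ('v \<Rightarrow>\<^sub>0 nat) \<Rightarrow>\<^sub>0 'k)"
  shows "p = 0"
proof -
  define e where "e = poly_eval Const (\<lambda>v. Var (inv_into UNIV f v) :: ('i \<Rightarrow>\<^sub>0 nat) \<Rightarrow>\<^sub>0 'k)"
  interpret e: comm_ring_hom e
    unfolding e_def by (rule Const.comm_ring_hom_poly_eval)
  have "e (poly_eval Const (\<lambda>b. Var (f b)) p) = p"
    unfolding e.hom_poly_eval unfolding e_def Const.poly_eval_Const Const.poly_eval_Var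
    by (simp add: inv_f_f[OF assms(1)] poly_eval_Const_Var_id)
  then show ?thesis using assms(2) by simp
qed

text \<open>Specialise the generic matrices to a tuple at which the generators become distinct
  variables: a relation between the generators then becomes a relation between variables.\<close>

lemma algebraically_independent_B:
  "algebraically_independent scalar (B_index n m) (\<lambda>b. Fract (B_elem n b) 1 :: 'k::field pol fract)"
  unfolding algebraically_independent_def
proof (intro allI impI, elim conjE)
  fix p :: "(gen_index \<Rightarrow>\<^sub>0 nat) \<Rightarrow>\<^sub>0 'k"
  assume vars: "vars p \<subseteq> B_index n m" and "poly_eval scalar (\<lambda>b. Fract (B_elem n b) 1) p = 0"
  then have 0: "poly_eval Const (B_elem n) p = 0"
    by (simp flip: to_fract_def to_fract_poly_eval)
  define t where "t b = to_fract (Var (gen_coord b) :: 'k pol)" for b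
  have "Var v \<noteq> (0 :: 'k pol)" for v
    by (metis Var_def lookup_single_eq lookup_zero zero_neq_one)
  then obtain Y where Y: "\<And>l. Y l \<in> carrier_mat n n" "\<And>b. b \<in> B_index n m \<Longrightarrow> gen_val n Y b = t b"
    using gen_val_surj[of t n m] by (auto simp: t_def)
  define h where "h = poly_eval scalar (\<lambda>c. case c of Coord l i j \<Rightarrow> Y l $$ (i - 1, j - 1))"
  interpret h: comm_ring_hom h
    unfolding h_def by (rule coord_hom_eval[OF Y(1)])
  have h_B: "h (B_elem n b) = t b" if "b \<in> B_index n m" for b
    unfolding B_elem_eq_gen_val h.hom_gen_val unfolding h_def coord_hom_eval(2)[OF Y(1)]
    by (rule Y(2)[OF that])
  have "0 = h (poly_eval Const (B_elem n) p)" by (simp add: 0)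
  also have "\<dots> = poly_eval scalar (\<lambda>b. h (B_elem n b)) p"
    unfolding h.hom_poly_eval by (simp add: h_def scalar.poly_eval_Const)
  also have "\<dots> = poly_eval scalar t p"
    using vars by (intro poly_eval_cong h_B) auto
  also have "\<dots> = to_fract (poly_eval Const (\<lambda>b. Var (gen_coord b)) p)"
    by (simp add: to_fract_poly_eval t_def[abs_def])
  finally show "p = 0"
    using rename_injective[OF inj_gen_coord] by (metis to_fract_eq_0_iff)
qed

text \<open>It suffices to exhibit one matrix whose corner minor is nonzero: the one whose
  coordinates \<open>edge_val\<close> are all 1.\<close>

lemma corner_minor_coord_mat_nonzero:
  assumes "r \<le> n"
  shows "corner_minor n (coord_mat n l) r \<noteq> (0 :: 'k::field pol)"
proof (cases "r = 0")
  case False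
  obtain A :: "'k pol fract mat" where A: "A \<in> carrier_mat n n" "\<And>a b. a < n \<Longrightarrow> b < n \<Longrightarrow> edge_val n A a b = 1"
    using edge_val_surj[of n "\<lambda>_ _. 1"] by auto
  define h where "h = poly_eval scalar (\<lambda>c. case c of Coord l i j \<Rightarrow> A $$ (i - 1, j - 1))"
  interpret h: comm_ring_hom h
    unfolding h_def by (rule coord_hom_eval[of "\<lambda>_. A"]) (rule A)
  have "map_mat h (coord_mat n l) = A"
    unfolding h_def by (rule coord_hom_eval(2)[of "\<lambda>_. A"]) (rule A)
  then have "h (corner_minor n (coord_mat n l) r) = corner_minor n A r"
    using assms by (simp add: h.hom_corner_minor)
  also have "\<dots> = 1" using assms False by (simp add: corner_minor_eq_edge_val A)
  finally show ?thesis by auto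
qed simp

section \<open>Generation\<close>

text \<open>Expresses the whole product through generators: the \<open>P\<close> above the diagonal,
  products of two corner minors on it.\<close>

lemma Lmat_Nmat_entry:
  assumes A: "A \<in> carrier_mat n n" and B: "B \<in> carrier_mat n n" and ac: "a < n" "c < n"
  shows "(Lmat n A * Nmat n B) $$ (a, c) =
    (if a = c then corner_minor n A (Suc a) * corner_minor n B (n - c)
     else if a < c then polyP n (n - a) (Suc c) A B else 0)"
proof (cases "a < c")
  case True
  then show ?thesis
    using polyP_eq[OF A B, of "n - a" "Suc c"] ac by (simp add: opp_def)
next
  case False
  then have "(\<Sum>b<c. Lmat n A $$ (a, b) * Nmat n B $$ (b, c)) = 0"
    using ac by (intro sum.neutral) (simp add: Lmat_lower)
  then show ?thesis
    using False mult_upper_triangular_col[of "Lmat n A" n "Nmat n B" a c] ac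
    by (auto simp: Nmat_lower Lmat_diag Nmat_diag Lmat_lower)
qed

text \<open>Forward substitution along row \<open>a\<close>: each entry of \<open>L\<close> comes
  from earlier ones by operations within \<open>F\<close>.\<close>

lemma right_divide_in_subfield:
  assumes F: "is_subfield F" and L: "L \<in> carrier_mat n n" and N: "N \<in> carrier_mat n n"
    and low: "\<And>b c. b < n \<Longrightarrow> c < b \<Longrightarrow> N $$ (b, c) = 0"
    and diag: "\<And>c. c < n \<Longrightarrow> N $$ (c, c) \<noteq> 0"
    and NF: "\<And>b c. b < n \<Longrightarrow> c < n \<Longrightarrow> N $$ (b, c) \<in> F"
    and LNF: "\<And>b c. b < n \<Longrightarrow> c < n \<Longrightarrow> (L * N) $$ (b, c) \<in> F"
    and a: "a < n"
  shows "c < n \<Longrightarrow> L $$ (a, c) \<in> F"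
proof (induction c rule: less_induct)
  case (less c)
  define r where "r = (\<Sum>b<c. L $$ (a, b) * N $$ (b, c))"
  have "r \<in> F"
    unfolding r_def using less NF
    by (intro subring_sum[OF is_subfield_imp_subring[OF F]] is_subfieldD(4)[OF F]) auto
  moreover have "L $$ (a, c) = ((L * N) $$ (a, c) - r) / N $$ (c, c)"
    using mult_upper_triangular_col[OF L N low a less(2)] diag[OF less(2)] by (simp add: r_def)
  ultimately show ?case
    using LNF[OF a less(2)] NF[OF less(2) less(2)] by (simp only: is_subfieldD[OF F])
qed

text \<open>Parametrises the unitriangular matrices by free entries above the diagonal.
  \<open>s\<close> is a total function so that \<open>polyfun\<close> applies; its other values are
  ignored.\<close>

definition utri :: "nat \<Rightarrow> (nat \<times> nat \<Rightarrow> 'r) \<Rightarrow> 'r::comm_ring_1 mat"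
  where "utri n s = mat n n (\<lambda>(a, b). if a = b then 1 else if a < b then s (a, b) else 0)"

lemma unitri_utri: "unitri n (utri n s)"
  by (auto simp: unitri_def utri_def)

lemma utri_index: "unitri n u \<Longrightarrow> utri n (\<lambda>ij. u $$ ij) = u"
  by (intro eq_matI) (auto simp: unitri_def utri_def)

lemma (in comm_ring_hom) map_mat_utri: "map_mat hom (utri n s) = utri n (\<lambda>ij. hom (s ij))"
  by (intro eq_matI) (auto simp: utri_def)

text \<open>No denominators in the parameters arise, because the inverse is written as an
  adjugate.\<close>

lemma polyfun_conj_eval:
  fixes Y :: "nat \<Rightarrow> 'r::comm_ring_1 mat"
  assumes Y: "\<And>l. Y l \<in> carrier_mat n n" and p: "p \<in> polyH n m"
  shows "polyfun (\<lambda>s. poly_eval \<phi> (conj_point Y (utri n s) (adj_mat (utri n s))) p)"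
proof (rule polyfun_poly_eval)
  fix v assume "v \<in> vars p"
  then obtain l i j where v: "v = Coord l i j" "i \<in> {1..n}" "j \<in> {1..n}"
    using polyH_coord[OF p] by metis
  have carr: "utri n s \<in> carrier_mat n n" "adj_mat (utri n s) \<in> carrier_mat n n" for s :: "nat \<times> nat \<Rightarrow> 'r"
    using unitriD(1)[OF unitri_utri[of n s]] adj_mat(1) by auto
  have carr': "utri n s * Y l \<in> carrier_mat n n" for s
    using carr(1) Y by (rule mult_carrier_mat)
  have entry: "polyfun (\<lambda>s :: nat \<times> nat \<Rightarrow> 'r. utri n s $$ (a, b))" if "a < n" "b < n" for a b
    using that by (cases a b rule: linorder_cases) (simp_all add: utri_def polyfun_const polyfun_coord)
  have "polyfun (\<lambda>s. (utri n s * Y l * adj_mat (utri n s)) $$ (i - 1, j - 1))"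
    using v carr carr' Y
    by (intro polyfun_mult_mat[where k = n and n = n and m = n] polyfun_adj_mat[where n = n] entry polyfun_const)
      auto
  then show "polyfun (\<lambda>s. conj_point Y (utri n s) (adj_mat (utri n s)) v)"
    by (simp add: conj_point_def v)
qed

section \<open>Conjugation of the generic matrices over the fraction field\<close>

definition coord_fract_mat :: "nat \<Rightarrow> nat \<Rightarrow> 'k::field pol fract mat"
  where "coord_fract_mat n l = map_mat to_fract (coord_mat n l)"

lemma coord_fract_mat_carrier [simp]: "coord_fract_mat n l \<in> carrier_mat n n"
  by (simp add: coord_fract_mat_def)

lemma coord_fract_mat_index:
  "i < n \<Longrightarrow> j < n \<Longrightarrow> coord_fract_mat n l $$ (i, j) = to_fract (Var (Coord l (Suc i) (Suc j)))"
  by (simp add: coord_fract_mat_def coord_mat_def)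

lemma to_fract_rho:
  fixes g h :: "'k::field mat"
  assumes g: "unitri n g" and h: "unitri n h" and gh: "g * h = 1\<^sub>m n" "h * g = 1\<^sub>m n"
    and p: "p \<in> polyH n m"
  shows "to_fract (rho n h p) =
    poly_eval scalar (conj_point (coord_fract_mat n) (map_mat scalar g) (map_mat scalar h)) p"
  unfolding rho_eq_conj_point[OF g h gh] to_fract_poly_eval
proof (rule poly_eval_cong)
  fix v assume "v \<in> vars p"
  then obtain l i j where v: "v = Coord l i j" "i \<in> {1..n}" "j \<in> {1..n}"
    using polyH_coord[OF p] by metis
  have "map_mat to_fract (map_mat Const a) = (map_mat scalar a :: 'k pol fract mat)" for a :: "'k mat"
    by (intro eq_matI) (auto simp: scalar_eq)
  then show "to_fract (conj_point (coord_mat n) (map_mat Const g) (map_mat Const h) v) =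
      conj_point (coord_fract_mat n) (map_mat scalar g) (map_mat scalar h) v"
    using unitriD(1)[OF g] unitriD(1)[OF h] v
    by (subst v, subst to_fract.hom_conj_point[of _ n]) (simp_all add: coord_fract_mat_def[abs_def])
qed

lemma unitri_inverse_eq_adj:
  assumes "unitri n u" "v \<in> carrier_mat n n" "u * v = 1\<^sub>m n"
  shows "v = adj_mat u"
  using mat_inverse_unique[OF unitriD(1)[OF assms(1)] unitriD(1)[OF unitri_adj(1)[OF assms(1)]] assms(2)
      unitri_adj(3)[OF assms(1)] assms(3)] by simp

text \<open>An identity in the group variable that holds at all points over an infinite field holds
  at the generic point.\<close>

lemma generic_conj_identity:
  fixes p q :: "'l::field pol"
  assumes inf: "infinite (UNIV :: 'l set)" and pq: "p \<in> polyH n m" "q \<in> polyH n m"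
    and inv: "\<And>g. g \<in> UT n \<Longrightarrow> rho n g p * q = p * rho n g q"
    and u: "unitri n u"
  shows "poly_eval scalar (conj_point (coord_fract_mat n) u (adj_mat u)) p * to_fract q =
    to_fract p * poly_eval scalar (conj_point (coord_fract_mat n) u (adj_mat u)) q"
proof -
  define E where "E s r = poly_eval scalar (conj_point (coord_fract_mat n) (utri n s) (adj_mat (utri n s))) r"
    for s and r :: "'l pol"
  have "E s p * to_fract q - to_fract p * E s q = 0" for s
  proof (rule polyfun_vanish[where f = "\<lambda>s. E s p * to_fract q - to_fract p * E s q"])
    show "polyfun (\<lambda>s. E s p * to_fract q - to_fract p * E s q)"
      unfolding E_def
      by (intro polyfun_diff polyfun_mult polyfun_const polyfun_conj_eval[where m = m] pq) simp_all
    show "infinite (range (scalar :: 'l \<Rightarrow> 'l pol fract))"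
      using inf by (simp add: finite_image_iff inj_def scalar_eq_iff)
    fix s :: "nat \<times> nat \<Rightarrow> 'l pol fract" assume s: "\<And>v. s v \<in> range scalar"
    \<comment> \<open>Parameters in \<open>range scalar\<close> come from a matrix \<open>g\<close>
      over \<open>'l\<close>. Conjugation by \<open>g\<close> is \<open>rho\<close> of its inverse
      \<open>h\<close>, to which the assumption applies.\<close>
    define c where "c v = inv_into UNIV scalar (s v)" for v
    have c: "s = (\<lambda>v. scalar (c v))" using s by (simp add: fun_eq_iff c_def f_inv_into_f)
    define g where "g = utri n c"
    define h where "h = adj_mat g"
    have g: "unitri n g" by (simp add: g_def unitri_utri)
    have h: "unitri n h" "g * h = 1\<^sub>m n" "h * g = 1\<^sub>m n"
      using unitri_adj[OF g] by (simp_all add: h_def)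
    have s: "utri n s = map_mat scalar g" by (simp add: c g_def scalar.map_mat_utri)
    have "map_mat scalar g * map_mat scalar h = (1\<^sub>m n :: 'l pol fract mat)"
      using unitriD(1)[OF g] unitriD(1)[OF h(1)] h
      by (simp flip: scalar.mat_hom_mult[of _ n n _ n] add: scalar.mat_hom_one)
    then have "adj_mat (utri n s) = map_mat scalar h"
      unfolding s using unitriD(1)[OF h(1)] g
      by (intro unitri_inverse_eq_adj[symmetric] scalar.map_mat_unitri) auto
    then have E: "E s r = to_fract (rho n h r)" if "r \<in> polyH n m" for r
      using to_fract_rho[OF g h that] by (simp add: E_def s)
    have "h \<in> UT n" using h by (simp add: UT_iff_unitri)
    then show "E s p * to_fract q - to_fract p * E s q = 0"
      using inv by (simp add: E pq flip: to_fract_mult)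
  qed
  from this[of "\<lambda>ij. u $$ ij"] show ?thesis
    by (simp add: E_def utri_index[OF u])
qed

lemma conj_assoc:
  fixes A :: "'r::comm_ring_1 mat"
  assumes "w \<in> carrier_mat n n" "g \<in> carrier_mat n n" "A \<in> carrier_mat n n" "v \<in> carrier_mat n n"
    "w' \<in> carrier_mat n n"
  shows "(w * g) * A * (v * w') = w * (g * A * v) * w'"
  using assms by (simp add: assoc_mult_mat[of _ n n _ n _ n])

lemma is_subfield_field_generated: "is_subfield (field_generated S)"
  unfolding is_subfield_def[of "field_generated S"] unfolding field_generated_def
  by (intro conjI ballI; simp add: is_subfieldD)

lemma field_generated_superset: "S \<subseteq> field_generated S"
  unfolding field_generated_def by auto

context
  fixes \<iota> :: "'k::field \<Rightarrow> 'l::field"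
  assumes hom: "comm_ring_hom \<iota>" and inj: "inj \<iota>"
begin

interpretation \<iota>: comm_ring_hom \<iota> by (rule hom)

interpretation bc: comm_ring_hom "base_change \<iota>"
  by (rule comm_ring_hom_map[OF hom])

interpretation j: comm_ring_hom "frac_map (base_change \<iota>)"
  by (rule comm_ring_hom_frac_map[OF bc.comm_ring_hom_axioms map_nonzero[OF hom inj]])

lemma frac_map_map_to_fract: "frac_map (base_change \<iota>) (to_fract p) = to_fract (base_change \<iota> p)"
  by (rule frac_map_to_fract[OF bc.comm_ring_hom_axioms map_nonzero[OF hom inj]])

text \<open>Base change fixes the generic matrices, so only the conjugating matrices and the
  coefficients are transported.\<close>

lemma frac_map_poly_eval_conj:
  assumes u: "u \<in> carrier_mat n n" and v: "v \<in> carrier_mat n n" and p: "p \<in> polyH n m"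
  shows "frac_map (base_change \<iota>) (poly_eval scalar (conj_point (coord_fract_mat n) u v) p) =
    poly_eval scalar (conj_point (coord_fract_mat n) (map_mat (frac_map (base_change \<iota>)) u) (map_mat (frac_map (base_change \<iota>)) v)) (base_change \<iota> p)"
proof -
  have "frac_map (base_change \<iota>) (poly_eval scalar (conj_point (coord_fract_mat n) u v) p) =
    poly_eval (\<lambda>c. scalar (\<iota> c)) (\<lambda>w. frac_map (base_change \<iota>) (conj_point (coord_fract_mat n) u v w)) p"
    unfolding j.hom_poly_eval by (simp add: scalar_eq frac_map_map_to_fract map_Const[OF hom inj] scalar_eq[abs_def])
  also have "\<dots> = poly_eval (\<lambda>c. scalar (\<iota> c))
      (conj_point (coord_fract_mat n) (map_mat (frac_map (base_change \<iota>)) u) (map_mat (frac_map (base_change \<iota>)) v)) p"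
  proof (rule poly_eval_cong)
    fix w assume "w \<in> vars p"
    then obtain l i k where w: "w = Coord l i k" "i \<in> {1..n}" "k \<in> {1..n}"
      using polyH_coord[OF p] by metis
    have "map_mat (frac_map (base_change \<iota>)) (coord_fract_mat n l) = coord_fract_mat n l" for l
      by (intro eq_matI) (simp_all add: coord_fract_mat_def coord_mat_def frac_map_map_to_fract map_Var[OF hom inj])
    then show "frac_map (base_change \<iota>) (conj_point (coord_fract_mat n) u v w) =
        conj_point (coord_fract_mat n) (map_mat (frac_map (base_change \<iota>)) u) (map_mat (frac_map (base_change \<iota>)) v) w"
      unfolding w using u v w by (subst j.hom_conj_point[of _ n]) simp_all
  qed
  also have "\<dots> = poly_eval scalar
      (conj_point (coord_fract_mat n) (map_mat (frac_map (base_change \<iota>)) u) (map_mat (frac_map (base_change \<iota>)) v)) (base_change \<iota> p)"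
    by (rule poly_eval_map[symmetric]) simp_all
  finally show ?thesis .
qed

text \<open>Transport \<open>u\<close> to the fraction field over the infinite field
  \<open>'l\<close>, use the generic identity there, and return by injectivity of
  \<open>frac_map\<close>. Thus invariance is tested over \<open>'l\<close>, while \<open>u\<close>
  and the identity obtained live over \<open>'k\<close>.\<close>

lemma descended_conj_identity:
  fixes p q :: "'k pol"
  assumes inf: "infinite (UNIV :: 'l set)" and pq: "p \<in> polyH n m" "q \<in> polyH n m"
    and inv: "\<And>g. g \<in> UT n \<Longrightarrow> rho n g (base_change \<iota> p) * base_change \<iota> q = base_change \<iota> p * rho n g (base_change \<iota> q)"
    and u: "unitri n u" and v: "v \<in> carrier_mat n n" "u * v = 1\<^sub>m n"
  shows "poly_eval scalar (conj_point (coord_fract_mat n) u v) p * to_fract q =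
    to_fract p * poly_eval scalar (conj_point (coord_fract_mat n) u v) q" (is "?l = ?r")
proof -
  let ?u = "map_mat (frac_map (base_change \<iota>)) u" and ?v = "map_mat (frac_map (base_change \<iota>)) v"
  note uD = unitriD(1)[OF u]
  have "?u * ?v = 1\<^sub>m n"
    using uD v by (simp flip: j.mat_hom_mult[of _ n n _ n] add: j.mat_hom_one)
  then have v': "?v = adj_mat ?u"
    using v u by (intro unitri_inverse_eq_adj j.map_mat_unitri) auto
  have "frac_map (base_change \<iota>) (?l - ?r) = 0"
    using generic_conj_identity[OF inf map_in_polyH[OF hom inj pq(1)] map_in_polyH[OF hom inj pq(2)] inv
        j.map_mat_unitri[OF u]]
    by (simp add: j.hom_minus j.hom_mult frac_map_poly_eval_conj[OF uD v(1) pq(1)]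
        frac_map_poly_eval_conj[OF uD v(1) pq(2)] frac_map_map_to_fract v')
  then have "?l - ?r = 0"
    by (rule frac_map_eq_0[OF bc.comm_ring_hom_axioms map_nonzero[OF hom inj], rotated])
  then show ?thesis by simp
qed

end

lemma corner_minor_coord_fract_mat:
  assumes "r \<le> n"
  shows "corner_minor n (coord_fract_mat n l) r = to_fract (corner_minor n (coord_mat n l) r)"
  unfolding coord_fract_mat_def using assms by (simp add: to_fract.hom_corner_minor)

section \<open>The field generated by the system, and the slice\<close>

context
  fixes n m :: nat and K :: "'k::field pol fract set"
  assumes m: "1 \<le> m"
  defines "K \<equiv> field_generated (range scalar \<union> (\<lambda>b. Fract (B_elem n b) 1) ` B_index n m)"
begin

lemma K_subfield: "is_subfield K"
  unfolding K_def by (rule is_subfield_field_generated)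

lemma scalar_in_K: "scalar c \<in> K"
  unfolding K_def by (rule subsetD[OF field_generated_superset]) simp

lemma gen_val_in_K:
  assumes "b \<in> B_index n m" shows "gen_val n (coord_fract_mat n) b \<in> K"
proof -
  have "gen_val n (coord_fract_mat n) b = to_fract (B_elem n b)"
    by (simp add: B_elem_eq_gen_val to_fract.hom_gen_val coord_fract_mat_def[abs_def])
  then show ?thesis
    unfolding K_def using field_generated_superset assms by (fastforce simp: to_fract_def)
qed

lemma corner_in_K:
  assumes "l \<in> {1..m}" "r \<le> n"
  shows "corner_minor n (coord_fract_mat n l) r \<in> K"
proof (cases "r = 0")
  case False
  then have r: "1 \<le> n + 1 - r" "n + 1 - r \<le> n" "opp n (n + 1 - r) = r" using assms by (auto simp: opp_def)
  then have "GenD l (n + 1 - r) \<in> B_index n m"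
    using assms by (auto simp: B_index_def)
  from gen_val_in_K[OF this] show ?thesis
    using r by (simp add: polyD_eq_corner[of _ n])
qed (simp add: is_subfieldD(2)[OF K_subfield])

lemma Lmat_Nmat_in_K:
  assumes l: "l \<in> {1..m}" and ac: "a < n" "c < n" and j: "j = 1 \<or> j = l"
  shows "(Lmat n (coord_fract_mat n j) * Nmat n (coord_fract_mat n l)) $$ (a, c) \<in> K"
proof -
  have j': "j \<in> {1..m}" using j l m by auto
  have "polyP n (n - a) (Suc c) (coord_fract_mat n j) (coord_fract_mat n l) \<in> K" if "a < c"
  \<comment> \<open>For \<open>j = l = 1\<close> the entry is a generator \<open>GenP\<close>, since
    \<open>GenP1\<close> starts at \<open>l = 2\<close>.\<close>
  proof (cases "j = l")
    case True
    then have "GenP l (n - a) (Suc c) \<in> B_index n m"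
      using l ac that by (auto simp: B_index_def opp_def)
    from gen_val_in_K[OF this] show ?thesis by (simp add: True)
  next
    case False
    then have "j = 1" "GenP1 l (n - a) (Suc c) \<in> B_index n m"
      using l ac that j by (auto simp: B_index_def opp_def)
    from gen_val_in_K[OF this(2)] show ?thesis by (simp add: \<open>j = 1\<close>)
  qed
  then show ?thesis
    using ac by (auto simp: Lmat_Nmat_entry simp del: index_mult_mat intro!: is_subfieldD(1,4)[OF K_subfield] corner_in_K l j')
qed

lemma corner_nonzero: "r \<le> n \<Longrightarrow> corner_minor n (coord_fract_mat n l) r \<noteq> (0 :: 'k pol fract)"
  by (simp add: corner_minor_coord_fract_mat corner_minor_coord_mat_nonzero)

text \<open>The unitriangular matrix that makes \<open>Lmat\<close> of the first generic matrix diagonal.\<close>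

definition slice_elt :: "'k pol fract mat"
  where "slice_elt = mat n n (\<lambda>(a, b). Lmat n (coord_fract_mat n 1) $$ (a, b) /
    corner_minor n (coord_fract_mat n 1) (Suc a))"

lemma unitri_slice_elt: "unitri n slice_elt"
  by (auto simp: unitri_def slice_elt_def Lmat_lower Lmat_diag corner_nonzero)

definition slice_mat :: "nat \<Rightarrow> 'k pol fract mat"
  where "slice_mat l = slice_elt * coord_fract_mat n l * adj_mat slice_elt"

lemma slice_mat_carrier: "slice_mat l \<in> carrier_mat n n"
  using unitriD(1)[OF unitri_slice_elt] unitriD(1)[OF unitri_adj(1)[OF unitri_slice_elt]]
  by (auto simp: slice_mat_def)

lemma slice_mat_in_K:
  assumes l: "l \<in> {1..m}" and ab: "a < n" "b < n"
  shows "slice_mat l $$ (a, b) \<in> K"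
proof -
  note g = unitri_slice_elt and v = unitri_adj(1)[OF unitri_slice_elt]
  have corner: "corner_minor n (slice_mat l) r = corner_minor n (coord_fract_mat n l) r" if "r \<le> n" for r
    unfolding slice_mat_def by (rule corner_minor_conj[OF _ g v that]) simp
  \<comment> \<open>The entries of \<open>slice_elt\<close> are not claimed to lie in
    \<open>K\<close>. Its product with \<open>Nmat\<close> is \<open>Lmat * Nmat\<close> with row
    \<open>a\<close> divided by a corner minor, and that does lie in \<open>K\<close>.\<close>
  have N: "Nmat n (slice_mat l) $$ (a, c) \<in> K" if "a < n" "c < n" for a c
  proof -
    let ?d = "corner_minor n (coord_fract_mat n 1) (Suc a)"
    have "Nmat n (slice_mat l) $$ (a, c) = (\<Sum>b<n. slice_elt $$ (a, b) * Nmat n (coord_fract_mat n l) $$ (b, c))"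
      unfolding slice_mat_def Nmat_conj[OF coord_fract_mat_carrier g v]
      using that unitriD(1)[OF g] by (intro index_mult_mat_sum) auto
    also have "\<dots> = (\<Sum>b<n. Lmat n (coord_fract_mat n 1) $$ (a, b) * Nmat n (coord_fract_mat n l) $$ (b, c)) / ?d"
      unfolding sum_divide_distrib using that by (intro sum.cong refl) (simp add: slice_elt_def)
    also have "\<dots> = (Lmat n (coord_fract_mat n 1) * Nmat n (coord_fract_mat n l)) $$ (a, c) / ?d"
      using that by (subst index_mult_mat_sum[of _ n n _ n]) auto
    also have "\<dots> \<in> K"
      using that m l by (intro is_subfieldD(8)[OF K_subfield] Lmat_Nmat_in_K corner_in_K) auto
    finally show ?thesis .
  qed
  \<comment> \<open>The product of \<open>Lmat\<close> and \<open>Nmat\<close> is unchanged by the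
    conjugation, so \<open>Lmat\<close> is obtained by triangular division.\<close>
  have L: "Lmat n (slice_mat l) $$ (a, c) \<in> K" if "a < n" "c < n" for a c
  proof (rule right_divide_in_subfield[OF K_subfield _ _ _ _ N])
    show "(Lmat n (slice_mat l) * Nmat n (slice_mat l)) $$ (b, c) \<in> K" if "b < n" "c < n" for b c
      unfolding slice_mat_def
      using that l by (simp add: Lmat_Nmat_conj[OF _ _ g v unitri_adj(3)[OF g]] Lmat_Nmat_in_K del: index_mult_mat)
  qed (use that in \<open>auto simp: Nmat_lower Nmat_diag corner corner_nonzero\<close>)
  show ?thesis
  proof (rule entries_in_subfield[OF K_subfield _ _ ab])
    show "edge_val n (slice_mat l) a b \<in> K" if "a < n" "b < n" for a b
    proof (cases "n - Suc a \<le> b")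
      case True
      then show ?thesis using that by (simp add: edge_val_Lmat L)
    next
      case False
      then show ?thesis using that by (simp add: edge_val_Nmat N)
    qed
  qed (simp add: corner corner_nonzero)
qed

text \<open>The corner minor of order 1 of the first matrix is its entry in row \<open>n\<close> and
  column 1, a variable that lies in \<open>K\<close>; its powers are distinct.\<close>

lemma infinite_K:
  assumes n: "1 \<le> n"
  shows "infinite K"
proof -
  define x where "x = corner_minor n (coord_mat n 1 :: 'k pol mat) 1"
  have x: "x = Var (Coord 1 n 1)"
    using n by (simp add: x_def corner_minor_def coord_mat_def det_single)
  have pow: "x ^ k = Poly_Mapping.single (Poly_Mapping.single (Coord 1 n 1) k) 1" for k
    by (induction k) (simp_all add: x Var_def mult_single flip: single_add)
  have "inj (\<lambda>k. to_fract (x ^ k))"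
  proof (rule injI)
    fix k k' assume "to_fract (x ^ k) = to_fract (x ^ k')"
    then have "Poly_Mapping.lookup (x ^ k) (Poly_Mapping.single (Coord 1 n 1) k)
      = Poly_Mapping.lookup (x ^ k') (Poly_Mapping.single (Coord 1 n 1) k)"
      by simp
    then have "Poly_Mapping.single (Coord 1 n 1) k' = Poly_Mapping.single (Coord 1 n 1) k"
      unfolding pow by (simp add: lookup_single when_def split: if_splits)
    then show "k = k'" by (metis lookup_single_eq)
  qed
  moreover have "to_fract x \<in> K"
    using corner_in_K[of 1 1] m n by (simp add: corner_minor_coord_fract_mat x_def)
  then have "range (\<lambda>k. to_fract (x ^ k)) \<subseteq> K"
    using subring_power[OF is_subfield_imp_subring[OF K_subfield]] by (auto simp: to_fract.hom_power)
  ultimately show ?thesis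
    using range_inj_infinite infinite_super by blast
qed

text \<open>The slice itself may lie in the zero set of \<open>q\<close>, so it is first moved by a unitriangular
  matrix \<open>w\<close> over \<open>K\<close>; this keeps the entries in \<open>K\<close>, which is infinite even if the
  base field is finite.\<close>

lemma descended_invariants_subset_K:
  fixes \<iota> :: "'k \<Rightarrow> 'l::field"
  assumes n: "1 \<le> n" and hom: "comm_ring_hom \<iota>" and inj: "inj \<iota>" and inf: "infinite (UNIV :: 'l set)"
  shows "descended_invariants \<iota> n m \<subseteq> K"
proof
  fix f assume "f \<in> descended_invariants \<iota> n m"
  then obtain p q where f: "f = Fract p q" and pq: "p \<in> polyH n m" "q \<in> polyH n m" "q \<noteq> 0"
    and inv: "\<And>g. g \<in> UT n \<Longrightarrow> rho n g (Poly_Mapping.map \<iota> p) * Poly_Mapping.map \<iota> q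
      = Poly_Mapping.map \<iota> p * rho n g (Poly_Mapping.map \<iota> q)"
    by (rule descended_invariants_obtain[OF hom inj]) blast
  define g where "g = slice_elt"
  define v where "v = adj_mat g"
  have g: "unitri n g" by (simp add: g_def unitri_slice_elt)
  have v: "unitri n v" "g * v = 1\<^sub>m n" "v * g = 1\<^sub>m n"
    using unitri_adj[OF g] by (simp_all add: v_def)
  note gD = unitriD(1)[OF g] and vD = unitriD(1)[OF v(1)]
  have slice: "slice_mat l = g * coord_fract_mat n l * v" for l
    by (simp add: slice_mat_def g_def v_def)
  define E where "E s r = poly_eval scalar (conj_point slice_mat (utri n s) (adj_mat (utri n s))) r"
    for s and r :: "'k pol"
  \<comment> \<open>If no such \<open>s\<close> existed, \<open>q\<close> would vanish at all
    conjugates of the slice, \<open>K\<close> being infinite. Conjugation by \<open>v\<close>, the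
    inverse of \<open>g\<close>, leads back to the generic tuple, so \<open>q\<close> would be
    0.\<close>
  have "\<exists>s. (\<forall>ij. s ij \<in> K) \<and> E s q \<noteq> 0"
  proof (rule ccontr)
    assume "\<not> ?thesis"
    then have van: "\<And>s. (\<And>ij. s ij \<in> K) \<Longrightarrow> E s q = 0" by blast
    have "polyfun (\<lambda>s. E s q)"
      unfolding E_def by (rule polyfun_conj_eval[OF slice_mat_carrier pq(2)])
    from polyfun_vanish[OF this infinite_K[OF n] van] have "E (\<lambda>ij. v $$ ij) q = 0" .
    moreover have "adj_mat v = g"
      using unitri_inverse_eq_adj[OF v(1) gD v(3)] by simp
    ultimately have 0: "poly_eval scalar (conj_point slice_mat v g) q = 0"
      by (simp add: E_def utri_index[OF v(1)])
    have "poly_eval scalar (conj_point slice_mat v g) q = poly_eval scalar (\<lambda>c. to_fract (Var c)) q"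
    proof (rule poly_eval_cong)
      fix c assume "c \<in> vars q"
      then obtain l i j where c: "c = Coord l i j" "i \<in> {1..n}" "j \<in> {1..n}"
        using polyH_coord[OF pq(2)] by metis
      show "conj_point slice_mat v g c = to_fract (Var c)"
        unfolding conj_point_def c coord.case slice
          conj_point_inverse[where Xs = "coord_fract_mat n", OF coord_fract_mat_carrier vD gD v(3,2)]
        using c by (subst coord_fract_mat_index) auto
    qed
    then show False using 0 pq(3) by (simp add: poly_eval_scalar_Var)
  qed
  then obtain s where s: "\<And>ij. s ij \<in> K" "E s q \<noteq> 0" by blast
  define w where "w = utri n s"
  have w: "unitri n w" by (simp add: w_def unitri_utri)
  have w': "unitri n (adj_mat w)" "w * adj_mat w = 1\<^sub>m n"
    using unitri_adj[OF w] by simp_all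
  note wD = unitriD(1)[OF w] and w'D = unitriD(1)[OF w'(1)]
  have "(w * g) * (v * adj_mat w) = w * (g * v) * adj_mat w"
    using wD gD vD w'D by (simp add: assoc_mult_mat[of _ n n _ n _ n])
  also have "\<dots> = 1\<^sub>m n" using wD w' by (simp add: v)
  finally have inverse: "(w * g) * (v * adj_mat w) = 1\<^sub>m n" .
  \<comment> \<open>The moved slice is the generic tuple conjugated by \<open>w * g\<close>, so the
    invariance identity applies with \<open>w * g\<close>.\<close>
  have "conj_point (coord_fract_mat n) (w * g) (v * adj_mat w) = conj_point slice_mat w (adj_mat w)"
    unfolding conj_point_def slice using wD gD vD w'D by (simp add: conj_assoc)
  then have "E s p * to_fract q = to_fract p * E s q"
    using descended_conj_identity[OF hom inj inf pq(1,2) inv unitri_mult[OF w g] _ inverse] vD w'D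
    by (simp add: E_def w_def)
  then have "f = E s p / E s q"
    using pq(3) s(2) by (simp add: f Fract_eq_divide field_simps)
  moreover have "E s r \<in> K" if r: "r \<in> polyH n m" for r
    unfolding E_def w_def[symmetric]
  proof (intro subring_poly_eval[OF is_subfield_imp_subring[OF K_subfield]] scalar_in_K)
    fix c assume "c \<in> vars r"
    then obtain l i j where c: "c = Coord l i j" "l \<in> {1..m}" "i \<in> {1..n}" "j \<in> {1..n}"
      using polyH_coord[OF r] by metis
    have "w $$ (a, b) \<in> K" if "a < n" "b < n" for a b
      using that s(1) is_subfieldD(1,2)[OF K_subfield] by (simp add: w_def utri_def)
    then have "(w * slice_mat l * adj_mat w) $$ (i - 1, j - 1) \<in> K"
      using c wD w'D slice_mat_carrier slice_mat_in_K
      by (intro subring_mult_mat[OF is_subfield_imp_subring[OF K_subfield], where n = n and k = n and m = n]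
          subring_adj_mat[OF is_subfield_imp_subring[OF K_subfield], where n = n]) auto
    then show "conj_point slice_mat w (adj_mat w) c \<in> K" by (simp add: conj_point_def c)
  qed
  ultimately show "f \<in> K" using pq by (simp add: is_subfieldD(8)[OF K_subfield])
qed

end

section \<open>Free generation for both notions of invariants\<close>

lemma freely_generated_descended_invariants:
  fixes \<iota> :: "'k::field \<Rightarrow> 'l::field"
  assumes "1 \<le> n" "1 \<le> m" and "comm_ring_hom \<iota>" "inj \<iota>" "infinite (UNIV :: 'l set)"
  shows "freely_generated scalar (descended_invariants \<iota> n m) (B_index n m) (\<lambda>b. Fract (B_elem n b) 1)"
  unfolding freely_generated_def
  by (intro conjI algebraically_independent_B equalityI descended_invariants_subset_K[OF assms(2,1,3-5)]
    field_generated_subset_descended_invariants[OF assms(3,4,2)])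

text \<open>If the field were finite, one plus the product of all \<open>[:- a, 1:]\<close> would
  have positive degree and no root.\<close>

lemma infinite_alg_closure: "infinite (UNIV :: 'k::field alg_closure set)"
proof
  assume fin: "finite (UNIV :: 'k alg_closure set)"
  define P :: "'k alg_closure poly" where "P = (\<Prod>a\<in>UNIV. [:- a, 1:])"
  have "poly P x = 0" for x
  proof -
    have "poly P x = (\<Prod>a\<in>UNIV. poly [:- a, 1:] x)"
      unfolding P_def by (rule poly_prod)
    also have "\<dots> = 0"
      by (rule prod_zero[OF fin]) (rule bexI[of _ x], simp_all)
    finally show ?thesis .
  qed
  then have "poly (P + 1) x \<noteq> 0" for x by simp
  moreover have "degree P = card (UNIV :: 'k alg_closure set)"
    unfolding P_def by (subst degree_prod_eq_sum_degree) auto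
  then have "degree (P + 1) > 0"
    using fin by (simp add: degree_add_eq_left finite_UNIV_card_ge_0)
  ultimately show False
    using alg_closed_imp_poly_has_root by blast
qed

theorem theorem3p1:
  fixes n m :: nat
  assumes "n \<ge> 1" and "m \<ge> 1"
  shows "freely_generated scalar (alg_invariants n m :: 'k::field pol fract set)
           (B_index n m) (\<lambda>b. Fract (B_elem n b) 1)
       \<and> (infinite (UNIV :: 'k set) \<longrightarrow>
          freely_generated scalar (invariants n m :: 'k pol fract set)
            (B_index n m) (\<lambda>b. Fract (B_elem n b) 1))"
proof (intro conjI impI)
  have "comm_ring_hom (to_ac :: 'k \<Rightarrow> 'k alg_closure)"
    by standard simp_all
  moreover have "alg_invariants n m = descended_invariants (to_ac :: 'k \<Rightarrow> 'k alg_closure) n m"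
    by (simp add: alg_invariants_def descended_invariants_def)
  ultimately show "freely_generated scalar (alg_invariants n m :: 'k pol fract set)
      (B_index n m) (\<lambda>b. Fract (B_elem n b) 1)"
    using freely_generated_descended_invariants[OF assms _ inj_to_ac infinite_alg_closure] by simp
  \<comment> \<open>Over an infinite field the identity takes the place of the embedding into the
    algebraic closure.\<close>
  assume inf: "infinite (UNIV :: 'k set)"
  have hom: "comm_ring_hom (\<lambda>c::'k. c)"
    by standard simp_all
  have inj: "inj (\<lambda>c::'k. c)"
    by simp
  have map: "Poly_Mapping.map (\<lambda>c::'k. c) p = p" for p :: "'k pol"
    by (simp add: poly_mapping_eqI Poly_Mapping.map.rep_eq when_def)
  have "f \<in> invariants n m \<longleftrightarrow> f \<in> descended_invariants (\<lambda>c::'k. c) n m" for f :: "'k pol fract"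
  proof (cases "f \<in> ratH n m")
    case True
    then obtain p q where "f = Fract p q" "p \<in> polyH n m" "q \<in> polyH n m" "q \<noteq> 0"
      by (auto simp: ratH_def)
    then have "frac_lift (polyH n m) (Poly_Mapping.map (\<lambda>c::'k. c)) f = f"
      by (simp add: frac_lift_Fract map)
    then show ?thesis using True by (simp add: descended_invariants_def)
  qed (auto simp: descended_invariants_def invariants_def)
  then have "invariants n m = descended_invariants (\<lambda>c::'k. c) n m" by blast
  then show "freely_generated scalar (invariants n m :: 'k pol fract set)
      (B_index n m) (\<lambda>b. Fract (B_elem n b) 1)"
    using freely_generated_descended_invariants[OF assms hom inj inf] by simp
qed

end
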